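(* Let $h\in\mathbb{N}$ be arbitrary. Consider the linear system $x_{t+1}=Ax_t+Bu_t+w_t$, $t\in\mathbb{N}_0$, with output $z_t=C_2x_t+D_{21}u_t$ and $x_0=0$, in closed loop with a controller policy $\pi_u$ and a scheduler policy $\pi_\sigma$, $\pi=(\pi_u,\pi_\sigma)$, as described in the context. Suppose that: (1) $(A,B)$ is controllable, $(A,C_2)$ is observable and $R=D_{21}^\top D_{21}>0$; (2) the scheduler is such that all inter-transmission times satisfy $\tau_\ell\le\bar h$, for a given $\bar h\in\mathbb{N}$; (3) the scheduler, controller and disturbance policies have the form $\sigma_t=\mu_{\sigma,t}(\mathcal{I}_t)$, $u_t=\mu_{u,t}(\mathcal{J}_t)$, $w_t=\mu_{w,t}(\mathcal{I}_t)$ given in the context; (4) $\gamma_h<\gamma_{h+1}$; (5) $\gamma$ is a real number with $\gamma_h<\gamma<\gamma_{h+1}$ for which there exists $\underline{\epsilon}>0$ such that for every $\xi\in\mathbb{R}^n$ and every $t\in\mathbb{N}$ either $\mathcal{T}(\xi,t,0,\gamma)\le h$, or $\mathcal{T}(\xi,t,\epsilon,\gamma)>h$ for every $\epsilon\in[-\underline{\epsilon},\underline{\epsilon}]$. Then there exists a disturbance $w\in\ell_2$ (with $w_0\neq 0$) such that at least one of the following two holds: (i) $\|z\|^2>\gamma^2\|w\|^2$, which implies that $\gamma_\pi\ge\gamma>\gamma_h$; (ii) $r_\pi(w)\ge\frac1h$.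
   Context: **System.** $A\in\mathbb{R}^{n\times n}$, $B\in\mathbb{R}^{n\times m}$, $x_t,w_t\in\mathbb{R}^n$, $u_t\in\mathbb{R}^m$, $z_t\in\mathbb{R}^p$, with $C_2^\top D_{21}=0$; $Q:=C_2^\top C_2$, $R:=D_{21}^\top D_{21}$. $\mathbb{N}=\{1,2,\dots\}$, $\mathbb{N}_0=\mathbb{N}\cup\{0\}$. For sequences, $\langle w,z\rangle=\sum_{t=0}^\infty w_t^\top z_t$, $\|w\|^2=\langle w,w\rangle$ (possibly $+\infty$), and $\ell_2$ is the Hilbert space of sequences with finite norm. The initial state is $x_0=0$ and $u_0=0$; disturbances are taken with $w_0\ne0$, so $x_1=w_0$. **Scheduler and controller.** $\sigma_t=1$ if the state $x_t$ is transmitted to the controller at time $t$ and $\sigma_t=0$ otherwise; $\sigma_1=1$. The transmission times are $s_0=1$, $s_{\ell+1}=s_\ell+\tau_\ell$, with $\tau_\ell=\min\{j\in\{1,\dots,\bar h\}:\sigma_{s_\ell+j}=1\}$. Let $\bar\ell(t)=\max\{\ell\in\mathbb{N}_0: s_\ell\le t\}$ and let $r_t=t-s_{\bar\ell(t)}$ be the time elapsed since the last transmission. The information sets are $\mathcal{J}_t=\{x_{s_{\bar\ell(t)}}\}\cup\{r_t\}$ (last transmitted state and elapsed time) and $\mathcal{I}_t=\{x_k: k\in\{s_{\bar\ell(t)},s_{\bar\ell(t)}+1,\dots,t\}\}$ (states from the last transmission time up to the current time; when the scheduler decides $\sigma_t$, the last transmission time is the most recent one before $t$). The policies are: scheduler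 $\sigma_t=\mu_{\sigma,t}(\mathcal{I}_t)$, controller $u_t=\mu_{u,t}(\mathcal{J}_t)$, disturbance $w_t=\mu_{w,t}(\mathcal{I}_t)$. Write $\pi_\sigma=(\mu_{\sigma,0},\mu_{\sigma,1},\dots)$, $\pi_u=(\mu_{u,0},\mu_{u,1},\dots)$ and $\pi=(\pi_u,\pi_\sigma)$. The control policy is known to the scheduler and to the disturbance policy. **Average transmission rate.** $r_\pi(w)=\limsup_{s\to\infty}\frac1s\sum_{t=0}^{s-1}\sigma_t$, for the closed loop with policies $\pi$ and disturbance $w$. **Attenuation bounds.** An attenuation bound $\gamma$ holds if $\|z\|^2\le\gamma^2\|w\|^2$ for all $w\in\ell_2$, with $x_0=0$. $\gamma_\pi$ is the infimum of all $\gamma$ for which this holds when the policies are $\pi$. For $h\in\mathbb{N}$, $\gamma_h$ is the infimum of all $\gamma$ for which there exists a controller policy $\pi_u$ such that this holds when the scheduler is the periodic one: $\sigma_t=1$ if $t$ is zero or an integer multiple of $h$, and $\sigma_t=0$ otherwise. **Riccati quantities.** For $\gamma>0$, $$F_a(P)=P+P(\gamma^2I-P)^{-1}P,\quad F_o(P)=A^\top PA+Q,$$ $$F_c(P)=A^\top PA+Q-A^\top PB(B^\top PB+R)^{-1}B^\top PA.$$ $\bar P_\gamma$ is the unique positive definite solution of $\bar P_\gamma=F_c(F_a(\bar P_\gamma))$ obtained as the limit of the monotone iteration $P_{t+1}=F_c(F_a(P_t))$, $P_0=0$ (with $\gamma^2I>P_t$ for all $t$). Set $M_1=\bar P_\gamma$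 and $M_{k+1}=F_o(F_a(M_k))$ for $k\in\{1,\dots,h\}$. It is known from earlier work that $M_{k+1}\ge M_k$, that $\gamma_h=\inf\{\gamma:\gamma^2I-M_h>0\}$ and that $\gamma_{h+1}\ge\gamma_h$. For $\gamma_h<\gamma<\gamma_{h+1}$, the matrix $\gamma^2I-\bar P_\gamma$ is invertible and the smallest eigenvalue of $\gamma^2I-M_{h+1}$ is negative; $v_{h,\gamma}$ denotes a (fixed) eigenvector of Euclidean norm one associated with this smallest eigenvalue, and $$L_\gamma=(\gamma^2I-\bar P_\gamma)^{-1}\bar P_\gamma.$$ **The map $\mathcal{T}$.** Given $\epsilon\in\mathbb{R}$, consider the following disturbance policy, used from a transmission time $s_\ell$ until the next transmission time $s_{\ell+1}$: $$w_k=L_\gamma(Ax_k+Bu_k)+\epsilon v_{h,\gamma}\ \text{ if }k=s_\ell,\qquad w_k=L_\gamma(Ax_k+Bu_k)\ \text{ if }\tau_\ell>1\text{ and }k\in\{s_\ell+1,\dots,s_{\ell+1}-1\}.$$ $\mathcal{T}(\xi,t,\epsilon,\gamma)=\tau_\ell$ denotes the resulting inter-transmission time when this disturbance policy is applied starting from the transmission time $t=s_\ell$ with state $x_{s_\ell}=\xi$, under the given controller and scheduler policies. *)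

theory Defs
  imports "HOL-Analysis.Analysis"
begin

section \<open>Matrices\<close>

definition pos_def :: "real^'n^'n \<Rightarrow> bool" where
  "pos_def M \<longleftrightarrow> transpose M = M \<and> (\<forall>x. x \<noteq> 0 \<longrightarrow> 0 < x \<bullet> (M *v x))"

definition matpow :: "real^'n^'n \<Rightarrow> nat \<Rightarrow> real^'n^'n" where
  "matpow A k = (((**) A) ^^ k) (mat 1)"

text \<open>Kalman rank conditions: the block matrices \<open>[B, AB, \<dots>, A^(n-1) B]\<close> and
  \<open>[C; CA; \<dots>; C A^(n-1)]\<close> have rank \<open>n\<close>.\<close>

definition controllable :: "real^'n^'n \<Rightarrow> real^'m^'n \<Rightarrow> bool" where
  "controllable A B \<longleftrightarrow> span (\<Union>k<CARD('n). columns (matpow A k ** B)) = UNIV"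

definition observable :: "real^'n^'n \<Rightarrow> real^'n^'p \<Rightarrow> bool" where
  "observable A C \<longleftrightarrow> span (\<Union>k<CARD('n). rows (C ** matpow A k)) = UNIV"

definition unit_min_eigenvector :: "real^'n^'n \<Rightarrow> real^'n \<Rightarrow> bool" where
  "unit_min_eigenvector M v \<longleftrightarrow> norm v = 1 \<and>
     (\<exists>l. M *v v = l *\<^sub>R v \<and> (\<forall>\<mu> y. y \<noteq> 0 \<longrightarrow> M *v y = \<mu> *\<^sub>R y \<longrightarrow> l \<le> \<mu>))"

section \<open>Signals\<close>

definition ell2 :: "(nat \<Rightarrow> real^'n) set" where
  "ell2 = {w. summable (\<lambda>t. (norm (w t))\<^sup>2)}"

definition sqnorm :: "(nat \<Rightarrow> real^'n) \<Rightarrow> ennreal" where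
  "sqnorm w = (\<Sum>t. ennreal ((norm (w t))\<^sup>2))"

section \<open>Closed loop\<close>

text \<open>An information set \<open>I\<^sub>t\<close> is the list \<open>[x\<^sub>s, \<dots>, x\<^sub>t]\<close> of the states since the last
  transmission time \<open>s\<close>; hence the last transmitted state is its head, the current state its
  last element, the elapsed time its length minus one, and \<open>t\<close> itself is a transmission time
  iff the list is a singleton. A controller policy maps the time, the last transmitted state
  and the elapsed time to the input.\<close>

type_synonym ('n, 'm) controller = "nat \<Rightarrow> real^'n \<Rightarrow> nat \<Rightarrow> real^'m"
type_synonym 'n scheduler = "nat \<Rightarrow> (real^'n) list \<Rightarrow> bool"
type_synonym 'n disturber = "nat \<Rightarrow> (real^'n) list \<Rightarrow> real^'n"

definition control :: "('n, 'm) controller \<Rightarrow> nat \<Rightarrow> (real^'n) list \<Rightarrow> real^'m" where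
  "control \<mu>\<^sub>u t I = \<mu>\<^sub>u t (hd I) (length I - 1)"

text \<open>\<open>info A B \<mu>\<^sub>u \<mu>\<^sub>\<sigma> \<mu>\<^sub>w s \<xi> j\<close> is the information set at time \<open>s + j\<close> (after the scheduling
  decision at that time) when \<open>s\<close> is a transmission time with state \<open>\<xi>\<close>. The scheduler
  decides on the states since the most recent transmission time before the current time.\<close>

primrec info :: "real^'n^'n \<Rightarrow> real^'m^'n \<Rightarrow> ('n, 'm) controller \<Rightarrow> 'n scheduler \<Rightarrow>
    'n disturber \<Rightarrow> nat \<Rightarrow> real^'n \<Rightarrow> nat \<Rightarrow> (real^'n) list" where
  "info A B \<mu>\<^sub>u \<mu>\<^sub>\<sigma> \<mu>\<^sub>w s \<xi> 0 = [\<xi>]"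
| "info A B \<mu>\<^sub>u \<mu>\<^sub>\<sigma> \<mu>\<^sub>w s \<xi> (Suc j) =
    (let I = info A B \<mu>\<^sub>u \<mu>\<^sub>\<sigma> \<mu>\<^sub>w s \<xi> j;
         x' = A *v last I + B *v control \<mu>\<^sub>u (s + j) I + \<mu>\<^sub>w (s + j) I
     in if \<mu>\<^sub>\<sigma> (s + Suc j) (I @ [x']) then [x'] else I @ [x'])"

text \<open>Closed loop for a disturbance signal \<open>w\<close>: \<open>x\<^sub>0 = 0\<close> and \<open>u\<^sub>0 = 0\<close>, so that \<open>x\<^sub>1 = w\<^sub>0\<close>,
  and the first transmission takes place at time 1.\<close>

definition cl_info where
  "cl_info A B \<mu>\<^sub>u \<mu>\<^sub>\<sigma> w t = info A B \<mu>\<^sub>u \<mu>\<^sub>\<sigma> (\<lambda>k _. w k) 1 (w 0) (t - 1)"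

definition cl_state where
  "cl_state A B \<mu>\<^sub>u \<mu>\<^sub>\<sigma> w t = (if t = 0 then 0 else last (cl_info A B \<mu>\<^sub>u \<mu>\<^sub>\<sigma> w t))"

definition cl_input where
  "cl_input A B \<mu>\<^sub>u \<mu>\<^sub>\<sigma> w t = (if t = 0 then 0 else control \<mu>\<^sub>u t (cl_info A B \<mu>\<^sub>u \<mu>\<^sub>\<sigma> w t))"

definition cl_sigma where
  "cl_sigma A B \<mu>\<^sub>u \<mu>\<^sub>\<sigma> w t \<longleftrightarrow> t \<noteq> 0 \<and> length (cl_info A B \<mu>\<^sub>u \<mu>\<^sub>\<sigma> w t) = 1"

definition cl_output where
  "cl_output A B C2 D21 \<mu>\<^sub>u \<mu>\<^sub>\<sigma> w t =
     C2 *v cl_state A B \<mu>\<^sub>u \<mu>\<^sub>\<sigma> w t + D21 *v cl_input A B \<mu>\<^sub>u \<mu>\<^sub>\<sigma> w t"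

text \<open>The time from a transmission time \<open>s\<close> to the next one (\<open>\<infinity>\<close> if there is none).\<close>

definition inter_time :: "(nat \<Rightarrow> bool) \<Rightarrow> nat \<Rightarrow> enat" where
  "inter_time \<sigma> s = Inf {enat j | j. 1 \<le> j \<and> \<sigma> (s + j)}"

definition avg_rate :: "(nat \<Rightarrow> bool) \<Rightarrow> ereal" where
  "avg_rate \<sigma> = limsup (\<lambda>s. ereal ((\<Sum>t<s. of_bool (\<sigma> t)) / real s))"

section \<open>Attenuation bounds\<close>

text \<open>Infima are taken over nonnegative \<open>\<gamma>\<close>, since only \<open>\<gamma>\<^sup>2\<close> occurs in the bound; they are
  \<open>\<infinity>\<close> if no \<open>\<gamma>\<close> qualifies.\<close>

definition gamma_policy :: "real^'n^'n \<Rightarrow> real^'m^'n \<Rightarrow> real^'n^'p \<Rightarrow> real^'m^'p \<Rightarrow>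
    ('n, 'm) controller \<Rightarrow> 'n scheduler \<Rightarrow> ereal" where
  "gamma_policy A B C2 D21 \<mu>\<^sub>u \<mu>\<^sub>\<sigma> = Inf {ereal \<gamma> | \<gamma>. 0 \<le> \<gamma> \<and>
     (\<forall>w\<in>ell2. sqnorm (cl_output A B C2 D21 \<mu>\<^sub>u \<mu>\<^sub>\<sigma> w) \<le> ennreal (\<gamma>\<^sup>2) * sqnorm w)}"

text \<open>Periodic scheduler: the transmission times are the multiples of \<open>h\<close>, including time 0,
  where the state \<open>x\<^sub>0 = 0\<close> is transmitted.\<close>

definition per_output :: "real^'n^'n \<Rightarrow> real^'m^'n \<Rightarrow> real^'n^'p \<Rightarrow> real^'m^'p \<Rightarrow>
    ('n, 'm) controller \<Rightarrow> nat \<Rightarrow> (nat \<Rightarrow> real^'n) \<Rightarrow> nat \<Rightarrow> real^'p" where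
  "per_output A B C2 D21 \<mu>\<^sub>u h w t =
     (let I = info A B \<mu>\<^sub>u (\<lambda>k _. h dvd k) (\<lambda>k _. w k) 0 0 t
      in C2 *v last I + D21 *v control \<mu>\<^sub>u t I)"

text \<open>The condition \<open>\<mu>\<^sub>u 0 0 0 = 0\<close> is the convention \<open>u\<^sub>0 = 0\<close>.\<close>

definition gamma_periodic :: "real^'n^'n \<Rightarrow> real^'m^'n \<Rightarrow> real^'n^'p \<Rightarrow> real^'m^'p \<Rightarrow>
    nat \<Rightarrow> ereal" where
  "gamma_periodic A B C2 D21 h = Inf {ereal \<gamma> | \<gamma>. 0 \<le> \<gamma> \<and> (\<exists>\<mu>\<^sub>u. \<mu>\<^sub>u 0 0 0 = 0 \<and>
     (\<forall>w\<in>ell2. sqnorm (per_output A B C2 D21 \<mu>\<^sub>u h w) \<le> ennreal (\<gamma>\<^sup>2) * sqnorm w))}"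

section \<open>Riccati quantities\<close>

definition F_a :: "real \<Rightarrow> real^'n^'n \<Rightarrow> real^'n^'n" where
  "F_a \<gamma> P = P + P ** matrix_inv (mat (\<gamma>\<^sup>2) - P) ** P"

definition F_o :: "real^'n^'n \<Rightarrow> real^'n^'p \<Rightarrow> real^'n^'n \<Rightarrow> real^'n^'n" where
  "F_o A C2 P = transpose A ** P ** A + transpose C2 ** C2"

definition F_c :: "real^'n^'n \<Rightarrow> real^'m^'n \<Rightarrow> real^'n^'p \<Rightarrow> real^'m^'p \<Rightarrow>
    real^'n^'n \<Rightarrow> real^'n^'n" where
  "F_c A B C2 D21 P = transpose A ** P ** A + transpose C2 ** C2
     - transpose A ** P ** B
       ** matrix_inv (transpose B ** P ** B + transpose D21 ** D21)
       ** (transpose B ** P ** A)"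

primrec P_iter :: "real^'n^'n \<Rightarrow> real^'m^'n \<Rightarrow> real^'n^'p \<Rightarrow> real^'m^'p \<Rightarrow> real \<Rightarrow>
    nat \<Rightarrow> real^'n^'n" where
  "P_iter A B C2 D21 \<gamma> 0 = 0"
| "P_iter A B C2 D21 \<gamma> (Suc t) = F_c A B C2 D21 (F_a \<gamma> (P_iter A B C2 D21 \<gamma> t))"

definition P_bar :: "real^'n^'n \<Rightarrow> real^'m^'n \<Rightarrow> real^'n^'p \<Rightarrow> real^'m^'p \<Rightarrow> real \<Rightarrow>
    real^'n^'n" where
  "P_bar A B C2 D21 \<gamma> = (THE P. pos_def P \<and> P = F_c A B C2 D21 (F_a \<gamma> P) \<and>
     (\<forall>t. pos_def (mat (\<gamma>\<^sup>2) - P_iter A B C2 D21 \<gamma> t)) \<and>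
     P_iter A B C2 D21 \<gamma> \<longlonglongrightarrow> P)"

text \<open>\<open>M_seq A B C2 D21 \<gamma> k\<close> is \<open>M\<^sub>k\<close> for \<open>k \<ge> 1\<close>; the value at 0 is irrelevant.\<close>

definition M_seq :: "real^'n^'n \<Rightarrow> real^'m^'n \<Rightarrow> real^'n^'p \<Rightarrow> real^'m^'p \<Rightarrow> real \<Rightarrow>
    nat \<Rightarrow> real^'n^'n" where
  "M_seq A B C2 D21 \<gamma> k = ((\<lambda>M. F_o A C2 (F_a \<gamma> M)) ^^ (k - 1)) (P_bar A B C2 D21 \<gamma>)"

definition L_gain :: "real^'n^'n \<Rightarrow> real^'m^'n \<Rightarrow> real^'n^'p \<Rightarrow> real^'m^'p \<Rightarrow> real \<Rightarrow>
    real^'n^'n" where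
  "L_gain A B C2 D21 \<gamma> =
     matrix_inv (mat (\<gamma>\<^sup>2) - P_bar A B C2 D21 \<gamma>) ** P_bar A B C2 D21 \<gamma>"

section \<open>The inter-transmission time map\<close>

text \<open>A singleton information set means that \<open>k\<close> is a transmission time.\<close>

definition T_disturber :: "real^'n^'n \<Rightarrow> real^'m^'n \<Rightarrow> ('n, 'm) controller \<Rightarrow>
    real^'n^'n \<Rightarrow> real^'n \<Rightarrow> real \<Rightarrow> 'n disturber" where
  "T_disturber A B \<mu>\<^sub>u L v \<epsilon> k I =
     L *v (A *v last I + B *v control \<mu>\<^sub>u k I) + (if length I = 1 then \<epsilon> *\<^sub>R v else 0)"

definition T_map :: "real^'n^'n \<Rightarrow> real^'m^'n \<Rightarrow> real^'n^'p \<Rightarrow> real^'m^'p \<Rightarrow>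
    ('n, 'm) controller \<Rightarrow> 'n scheduler \<Rightarrow> real^'n \<Rightarrow> real^'n \<Rightarrow> nat \<Rightarrow> real \<Rightarrow> real \<Rightarrow> enat" where
  "T_map A B C2 D21 \<mu>\<^sub>u \<mu>\<^sub>\<sigma> v \<xi> t \<epsilon> \<gamma> =
     inter_time (\<lambda>k. length (info A B \<mu>\<^sub>u \<mu>\<^sub>\<sigma>
       (T_disturber A B \<mu>\<^sub>u (L_gain A B C2 D21 \<gamma>) v \<epsilon>) t \<xi> (k - t)) = 1) t"

section \<open>The closed loop in terms of signals\<close>

definition last_tx :: "(nat \<Rightarrow> bool) \<Rightarrow> nat \<Rightarrow> nat" where
  "last_tx \<sigma> t = Max {s. s \<le> t \<and> \<sigma> s}"

lemma info_nonempty: "info A B \<mu>\<^sub>u \<mu>\<^sub>\<sigma> \<mu>\<^sub>w s \<xi> j \<noteq> []"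
  by (induction j) (auto simp: Let_def)

lemma last_tx_tx: "\<sigma> t \<Longrightarrow> last_tx \<sigma> t = t"
  unfolding last_tx_def by (rule Max_eqI) auto

lemma last_tx_Suc_no_tx: "\<not> \<sigma> (Suc t) \<Longrightarrow> last_tx \<sigma> (Suc t) = last_tx \<sigma> t"
  unfolding last_tx_def by (rule arg_cong[where f = Max]) (auto simp: le_Suc_eq)

lemma last_tx_le: "\<sigma> s \<Longrightarrow> s \<le> t \<Longrightarrow> last_tx \<sigma> t \<le> t"
  unfolding last_tx_def by (subst Max_le_iff) auto

lemma cl_state_0: "cl_state A B \<mu>\<^sub>u \<mu>\<^sub>\<sigma> w 0 = 0"
  and cl_input_0: "cl_input A B \<mu>\<^sub>u \<mu>\<^sub>\<sigma> w 0 = 0"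
  and cl_sigma_1: "cl_sigma A B \<mu>\<^sub>u \<mu>\<^sub>\<sigma> w 1"
  by (simp_all add: cl_state_def cl_input_def cl_sigma_def cl_info_def)

lemma cl_state_Suc:
  "cl_state A B \<mu>\<^sub>u \<mu>\<^sub>\<sigma> w (Suc t) =
     A *v cl_state A B \<mu>\<^sub>u \<mu>\<^sub>\<sigma> w t + B *v cl_input A B \<mu>\<^sub>u \<mu>\<^sub>\<sigma> w t + w t"
  by (cases t) (auto simp: cl_state_def cl_input_def cl_info_def Let_def)

lemma cl_info_Suc:
  assumes "t \<ge> 1"
  shows "cl_info A B \<mu>\<^sub>u \<mu>\<^sub>\<sigma> w (Suc t) =
    (let I = cl_info A B \<mu>\<^sub>u \<mu>\<^sub>\<sigma> w t @ [cl_state A B \<mu>\<^sub>u \<mu>\<^sub>\<sigma> w (Suc t)]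
     in if \<mu>\<^sub>\<sigma> (Suc t) I then [cl_state A B \<mu>\<^sub>u \<mu>\<^sub>\<sigma> w (Suc t)] else I)"
  using assms by (cases t) (auto simp: cl_state_def cl_info_def Let_def)

lemma cl_sigma_Suc':
  assumes "t \<ge> 1"
  shows "cl_sigma A B \<mu>\<^sub>u \<mu>\<^sub>\<sigma> w (Suc t) \<longleftrightarrow>
    \<mu>\<^sub>\<sigma> (Suc t) (cl_info A B \<mu>\<^sub>u \<mu>\<^sub>\<sigma> w t @ [cl_state A B \<mu>\<^sub>u \<mu>\<^sub>\<sigma> w (Suc t)])"
  using assms info_nonempty
  by (auto simp: cl_sigma_def cl_info_Suc Let_def) (simp add: cl_info_def info_nonempty)

lemma cl_info_eq:
  assumes "t \<ge> 1"
  shows "cl_info A B \<mu>\<^sub>u \<mu>\<^sub>\<sigma> w t =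
    map (cl_state A B \<mu>\<^sub>u \<mu>\<^sub>\<sigma> w) [last_tx (cl_sigma A B \<mu>\<^sub>u \<mu>\<^sub>\<sigma> w) t..<Suc t]"
  using assms
proof (induction t rule: dec_induct)
  case base
  have "last_tx (cl_sigma A B \<mu>\<^sub>u \<mu>\<^sub>\<sigma> w) 1 = 1"
    by (rule last_tx_tx[of "cl_sigma A B \<mu>\<^sub>u \<mu>\<^sub>\<sigma> w", OF cl_sigma_1])
  then show ?case
    by (simp add: cl_info_def cl_state_def)
next
  case (step t)
  let ?\<sigma> = "cl_sigma A B \<mu>\<^sub>u \<mu>\<^sub>\<sigma> w"
  have le: "last_tx ?\<sigma> t \<le> t"
    using last_tx_le[of ?\<sigma>, OF cl_sigma_1] step.hyps by blast
  show ?case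
  proof (cases "?\<sigma> (Suc t)")
    case True
    moreover have "cl_info A B \<mu>\<^sub>u \<mu>\<^sub>\<sigma> w (Suc t) = [cl_state A B \<mu>\<^sub>u \<mu>\<^sub>\<sigma> w (Suc t)]"
      using True step.hyps by (simp add: cl_info_Suc cl_sigma_Suc' Let_def)
    ultimately show ?thesis
      by (simp add: last_tx_tx[of ?\<sigma>])
  next
    case False
    moreover have "cl_info A B \<mu>\<^sub>u \<mu>\<^sub>\<sigma> w (Suc t) =
        cl_info A B \<mu>\<^sub>u \<mu>\<^sub>\<sigma> w t @ [cl_state A B \<mu>\<^sub>u \<mu>\<^sub>\<sigma> w (Suc t)]"
      using False step.hyps by (simp add: cl_info_Suc cl_sigma_Suc' Let_def)
    ultimately show ?thesis
      using le step.IH by (simp add: last_tx_Suc_no_tx[of ?\<sigma>])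
  qed
qed

text \<open>The scheduler sees the states from the most recent transmission time before the current
  time, the controller the last transmitted state and the elapsed time.\<close>

lemma cl_sigma_Suc:
  assumes "t \<ge> 1"
  shows "cl_sigma A B \<mu>\<^sub>u \<mu>\<^sub>\<sigma> w (Suc t) \<longleftrightarrow> \<mu>\<^sub>\<sigma> (Suc t)
    (map (cl_state A B \<mu>\<^sub>u \<mu>\<^sub>\<sigma> w) [last_tx (cl_sigma A B \<mu>\<^sub>u \<mu>\<^sub>\<sigma> w) t..<Suc (Suc t)])"
proof -
  have "last_tx (cl_sigma A B \<mu>\<^sub>u \<mu>\<^sub>\<sigma> w) t \<le> t"
    using last_tx_le[of "cl_sigma A B \<mu>\<^sub>u \<mu>\<^sub>\<sigma> w", OF cl_sigma_1] assms by blast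
  then show ?thesis
    using assms by (simp add: cl_sigma_Suc' cl_info_eq)
qed

lemma cl_input_eq:
  assumes "t \<ge> 1"
  shows "cl_input A B \<mu>\<^sub>u \<mu>\<^sub>\<sigma> w t =
    \<mu>\<^sub>u t (cl_state A B \<mu>\<^sub>u \<mu>\<^sub>\<sigma> w (last_tx (cl_sigma A B \<mu>\<^sub>u \<mu>\<^sub>\<sigma> w) t))
      (t - last_tx (cl_sigma A B \<mu>\<^sub>u \<mu>\<^sub>\<sigma> w) t)"
proof -
  have "last_tx (cl_sigma A B \<mu>\<^sub>u \<mu>\<^sub>\<sigma> w) t \<le> t"
    using last_tx_le[of "cl_sigma A B \<mu>\<^sub>u \<mu>\<^sub>\<sigma> w", OF cl_sigma_1] assms by blast
  then show ?thesis
    using assms by (simp add: cl_input_def control_def cl_info_eq hd_map hd_upt del: upt_Suc)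
qed

end

theory Submission
  imports Defs "HOL-Real_Asymp.Real_Asymp"
begin

text \<open>
  Suppose that no disturbance violates the bound \<open>\<gamma>\<close>. The task is then to build a disturbance in
  \<open>\<ell>\<^sub>2\<close> that makes the scheduler transmit at rate at least \<open>1 / h\<close>. Fix \<open>b = g\<^sup>2\<close> with \<open>g\<close>
  strictly between \<open>\<gamma>\<close> and the bound of the periodic scheduler with period \<open>h + 1\<close>, and look
  at the zero-sum game with stage payoff \<open>|z|\<^sup>2 - b |w|\<^sup>2\<close>.

  The Riccati iteration for this game started at \<open>0\<close> computes quadratic forms that the disturbance
  can secure against the given loop. As the loop attenuates with \<open>\<gamma>\<^sup>2 < b\<close>, these forms stay below
  \<open>\<gamma>\<^sup>2 I\<close>, so the iteration never breaks down and it increases to a solution \<open>P\<close> of the Riccati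
  equation (\<open>riccati_solution\<close>). Completing squares with \<open>P\<close> turns the accumulated payoff plus the
  terminal value \<open>x \<bullet> P x\<close> into the sum of \<open>|u - K x|\<^sup>2\<close> minus the sum of \<open>|w - L (A x + B u)|\<^sup>2\<close>, in the norms
  \<open>sform\<close> and \<open>zform\<close>; attenuation says that this quantity is never positive.

  Now consider \<open>h + 1\<close> steps that start with a transmission and contain no other one. If the disturbance deviates from its
  saddle-point gain by \<open>e\<close>, the state deviates by \<open>deviation A L e\<close>, of which the controller sees
  nothing. If no \<open>e\<close> made the resulting \<open>deviation_gain\<close> positive, the controller that follows the saddle
  trajectory predicted from the last transmitted state would achieve \<open>g\<close> with period \<open>h + 1\<close>
  (\<open>periodic_controller\<close>), contradicting the choice of \<open>g\<close>. So some \<open>e\<close> has positive gain. Playing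
  \<open>\<kappa> e\<close> or \<open>- \<kappa> e\<close>, with \<open>\<kappa>\<^sup>2\<close> a fixed multiple of the disturbance energy spent so far, would recover
  more than was ever spent; hence one of the two signs forces a transmission within \<open>h\<close> steps
  (\<open>early_transmission\<close>).

  Repeating this makes the energy grow geometrically, so it has to be interrupted. Steering the
  state to \<open>0\<close> takes one inter-transmission time, at most \<open>hbar\<close> (\<open>reset\<close>), and the future of the loop depends only
  on the transmission time and the transmitted state. Therefore the energy spent up to a transmission
  of the state \<open>0\<close> at time \<open>s\<close> may be replaced by any smaller amount with which the same situation can be reached. Call
  \<open>s\<close> cheap if this amount can be made arbitrarily small. From a cheap time one can force any
  number \<open>n\<close> of early transmissions and then reset, with arbitrarily little energy; as the end time
  of such a block lies in a finite window, some end time works for all energies, and it is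
  cheap again (\<open>cheap_block\<close>). Gluing blocks with \<open>n = 0, 1, 2, \<dots>\<close> and energies \<open>2\<^sup>-\<^sup>n\<close> yields a
  disturbance in \<open>\<ell>\<^sub>2\<close>. Block \<open>n\<close> has at least \<open>n\<close> transmissions in at most \<open>n h + hbar\<close> steps, so
  the resets do not count in the limit and the rate is at least \<open>1 / h\<close>.
\<close>

section \<open>Quadratic forms\<close>

abbreviation qf :: "real^'n^'n \<Rightarrow> real^'n \<Rightarrow> real" where
  "qf M x \<equiv> x \<bullet> (M *v x)"

definition selfadj :: "real^'n^'n \<Rightarrow> bool" where
  "selfadj M \<longleftrightarrow> (\<forall>x y. x \<bullet> (M *v y) = y \<bullet> (M *v x))"

lemma inner_transpose_left: "(transpose M *v x) \<bullet> y = x \<bullet> (M *v y)"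
  for M :: "real^'n^'m"
  by (simp add: dot_lmul_matrix)

lemma inner_transpose_right: "x \<bullet> (transpose M *v y) = (M *v x) \<bullet> y"
  for M :: "real^'n^'m"
  by (metis inner_commute inner_transpose_left)

lemma mat_vector_mult: "mat c *v x = c *\<^sub>R x" for x :: "real^'n"
proof -
  have "mat c = c *\<^sub>R (mat 1 :: real^'n^'n)"
    by (simp add: mat_def vec_eq_iff)
  then show ?thesis
    by (metis scaleR_matrix_vector_assoc matrix_vector_mul_lid)
qed

lemma pos_def_bounded_below:
  fixes D :: "real^'m^'p"
  assumes "pos_def (transpose D ** D)"
  obtains c where "0 < c" "\<And>u. norm u \<le> c * norm (D *v u)"
proof -
  have "D *v u \<noteq> 0" if "u \<noteq> 0" for u
  proof
    assume "D *v u = 0"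
    then have "u \<bullet> ((transpose D ** D) *v u) = 0"
      by (simp flip: matrix_vector_mul_assoc)
    with assms that show False
      by (auto simp: pos_def_def)
  qed
  then have "inj ((*v) D)"
    by (metis (no_types) linear_injective_0 matrix_vector_mul_linear)
  then obtain c where "0 < c" "\<And>u. c * norm u \<le> norm (D *v u)"
    using linear_inj_bounded_below_pos matrix_vector_mul_linear by blast
  then have "0 < 1 / c" "\<And>u. norm u \<le> (1 / c) * norm (D *v u)"
    by (simp_all add: field_simps)
  then show thesis
    using that by blast
qed

lemma invertible_if_definite:
  fixes M :: "real^'n^'n"
  assumes "\<And>x. x \<noteq> 0 \<Longrightarrow> 0 < qf M x"
  shows "invertible M"
proof -
  have "\<forall>x. M *v x = 0 \<longrightarrow> x = 0"
    using assms by (metis inner_zero_right less_irrefl)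
  then show ?thesis
    by (metis invertible_left_inverse matrix_left_invertible_ker)
qed

lemma invertible_right_vector:
  assumes "invertible M"
  shows "M *v (matrix_inv M *v x) = x"
proof -
  have "M ** matrix_inv M = mat 1"
    using assms unfolding invertible_def matrix_inv_def by (rule someI2_ex) blast
  then show ?thesis
    by (simp add: matrix_vector_mul_assoc)
qed

lemma matrix_vector_mult_uminus: "(- M) *v x = - (M *v x)" for M :: "real^'n^'m"
  by (simp add: matrix_vector_mult_def vec_eq_iff sum_negf)

lemma norm_matrix_vector_le:
  fixes M :: "real^'n^'m"
  obtains c where "0 \<le> c" "\<And>x. norm (M *v x) \<le> c * norm x"
  using onorm[of "(*v) M"] onorm_pos_le[of "(*v) M"] matrix_vector_mul_bounded_linear[of M] by blast

lemma tendsto_matrix_vector_mult: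
  fixes M :: "'a \<Rightarrow> real^'n^'m"
  assumes "(M \<longlongrightarrow> N) F" "(x \<longlongrightarrow> y) F"
  shows "((\<lambda>i. M i *v x i) \<longlongrightarrow> N *v y) F"
  unfolding matrix_vector_mult_def
  by (intro vec_tendstoI) (simp, intro tendsto_intros tendsto_vec_nth assms)

lemma bounded_matrices:
  fixes M :: "'a \<Rightarrow> real^'n^'m"
  assumes "\<And>i x. norm (M i *v x) \<le> c * norm x"
  shows "bounded (range M)"
proof -
  have "norm (M i) \<le> (\<Sum>a\<in>(UNIV::'m set). \<Sum>b\<in>(UNIV::'n set). c)" for i
  proof -
    have "\<bar>M i $ a $ b\<bar> \<le> c" for a b
    proof -
      have "M i $ a $ b = (M i *v axis b 1) $ a"
        by (simp add: matrix_vector_mul_component inner_axis)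
      also have "\<bar>\<dots>\<bar> \<le> norm (M i *v axis b 1)"
        by (rule component_le_norm_cart)
      also have "\<dots> \<le> c * norm (axis b (1::real))"
        by (rule assms)
      finally show ?thesis
        by (simp add: norm_axis_1)
    qed
    then have "norm (M i $ a) \<le> (\<Sum>b\<in>(UNIV::'n set). c)" for a
      by (intro order_trans[OF norm_le_l1_cart] sum_mono)
    moreover have "norm (M i) \<le> (\<Sum>a\<in>UNIV. norm (M i $ a))"
      unfolding norm_vec_def by (intro L2_set_le_sum) auto
    ultimately show ?thesis
      by (meson order_trans sum_mono)
  qed
  then show ?thesis
    by (auto simp: bounded_iff)
qed

text \<open>Expand \<open>0 \<le> qf P (a x - P x)\<close> and bound the two diagonal terms by the upper bound on \<open>qf P\<close>.\<close>
lemma selfadj_norm_le: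
  fixes P :: "real^'n^'n"
  assumes "selfadj P" "\<And>x. 0 \<le> qf P x" "\<And>x. qf P x \<le> a * (norm x)\<^sup>2" "0 \<le> a"
  shows "norm (P *v x) \<le> a * norm x"
proof -
  define y where "y = P *v x"
  have yx: "y \<bullet> (P *v x) = (norm y)\<^sup>2" "x \<bullet> (P *v y) = (norm y)\<^sup>2"
    using assms(1) by (auto simp: y_def power2_norm_eq_inner selfadj_def)
  have "0 \<le> qf P (a *\<^sub>R x - y)"
    by (rule assms)
  also have "\<dots> = a\<^sup>2 * qf P x - 2 * a * (norm y)\<^sup>2 + qf P y"
    using yx by (simp add: matrix_vector_mult_diff_distrib matrix_vector_mult_scaleR
        inner_diff_left inner_diff_right power2_eq_square algebra_simps)
  also have "\<dots> \<le> a\<^sup>2 * (a * (norm x)\<^sup>2) - 2 * a * (norm y)\<^sup>2 + a * (norm y)\<^sup>2"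
    using assms(3)[of x] assms(3)[of y] assms(4) by (intro add_mono diff_mono mult_left_mono assms(3,4)) auto
  finally have "a * (norm y)\<^sup>2 \<le> a * (a * norm x)\<^sup>2"
    by (simp add: power2_eq_square algebra_simps)
  show ?thesis
  proof (cases "a = 0")
    case True
    \<comment> \<open>The expansion is vacuous for \<open>a = 0\<close>; there the form vanishes, hence so does \<open>P\<close>.\<close>
    have "qf P z = 0" for z
      using assms(2)[of z] assms(3)[of z] True by simp
    then have "qf P (x + y) = 0" "qf P x = 0" "qf P y = 0"
      by auto
    then have "2 * (norm y)\<^sup>2 = 0"
      using yx by (simp add: matrix_vector_right_distrib inner_add_left inner_add_right)
    then show ?thesis
      by (simp add: y_def True)
  next
    case False
    then have "(norm y)\<^sup>2 \<le> (a * norm x)\<^sup>2"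
      using \<open>a * (norm y)\<^sup>2 \<le> _\<close> assms(4) by simp
    then show ?thesis
      unfolding y_def using assms(4) by (simp add: power2_le_iff_abs_le)
  qed
qed

section \<open>One step of the Riccati recursion\<close>

text \<open>The weight \<open>D\<^sup>T D + B\<^sup>T (P + P L) B\<close> of a deviation of the control from its saddle-point value.\<close>
definition sform :: "real^'m^'n \<Rightarrow> real^'m^'p \<Rightarrow> real^'n^'n \<Rightarrow> real^'n^'n \<Rightarrow> real^'m \<Rightarrow> real" where
  "sform B D P L u = (norm (D *v u))\<^sup>2 + (B *v u) \<bullet> (P *v (B *v u + L *v (B *v u)))"

text \<open>The weight \<open>b I - P\<close> of a deviation of the disturbance.\<close>
definition zform :: "real \<Rightarrow> real^'n^'n \<Rightarrow> real^'n \<Rightarrow> real" where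
  "zform b P e = b * (norm e)\<^sup>2 - qf P e"

text \<open>\<open>P'\<close> is the value of one stage of the game with terminal value \<open>P\<close>, and \<open>L\<close>, \<open>K\<close> are the gains
  of the optimal disturbance (after the control) and the optimal control. With
  \<open>P\<^sub>a = P + P L = F_a P\<close> and \<open>S\<close> the weight of \<open>sform\<close>, the three clauses read \<open>(b I - P) L = P\<close>,
  \<open>S K = - B\<^sup>T P\<^sub>a A\<close> and \<open>P' = A\<^sup>T P\<^sub>a (A + B K) + C\<^sup>T C\<close>. They contain no matrix inverse and are
  pointwise, so they pass to limits along convergent gains.\<close>
definition riccati_step :: "real^'n^'n \<Rightarrow> real^'m^'n \<Rightarrow> real^'n^'p \<Rightarrow> real^'m^'p \<Rightarrow> real \<Rightarrow>
    real^'n^'n \<Rightarrow> real^'n^'n \<Rightarrow> real^'n^'m \<Rightarrow> real^'n^'n \<Rightarrow> bool" where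
  "riccati_step A B C D b P L K P' \<longleftrightarrow>
     (\<forall>y. b *\<^sub>R (L *v y) - P *v (L *v y) = P *v y) \<and>
     (\<forall>u x. (D *v u) \<bullet> (D *v (K *v x)) + (B *v u) \<bullet> (P *v (B *v (K *v x) + L *v (B *v (K *v x)))) =
        - ((B *v u) \<bullet> (P *v (A *v x + L *v (A *v x))))) \<and>
     (\<forall>x. qf P' x = (A *v x) \<bullet> (P *v (A *v x + L *v (A *v x)))
        + (A *v x) \<bullet> (P *v (B *v (K *v x) + L *v (B *v (K *v x)))) + (norm (C *v x))\<^sup>2)"

text \<open>The first Riccati relation gives \<open>P L = L\<^sup>T (b I - P) L\<close>, which is symmetric.\<close>
lemma gain_selfadj:
  fixes P L :: "real^'n^'n"
  assumes "selfadj P" and L: "\<And>y. b *\<^sub>R (L *v y) - P *v (L *v y) = P *v y"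
  shows "x \<bullet> (P *v (L *v y)) = y \<bullet> (P *v (L *v x))"
proof -
  have "x \<bullet> (P *v (L *v y)) = (L *v y) \<bullet> (P *v x)"
    using assms(1) by (simp add: selfadj_def)
  also have "\<dots> = (L *v y) \<bullet> (b *\<^sub>R (L *v x) - P *v (L *v x))"
    by (simp add: L)
  also have "\<dots> = (L *v x) \<bullet> (b *\<^sub>R (L *v y) - P *v (L *v y))"
    using assms(1) by (simp add: selfadj_def inner_diff_right inner_commute)
  also have "\<dots> = y \<bullet> (P *v (L *v x))"
    using assms(1) by (simp add: selfadj_def L)
  finally show ?thesis .
qed

text \<open>Completing the square in the disturbance \<open>w\<close>, for a given undisturbed next state \<open>y\<close>.\<close>
lemma maximize_disturbance:
  fixes P L :: "real^'n^'n"
  assumes "selfadj P" and L: "\<And>y. b *\<^sub>R (L *v y) - P *v (L *v y) = P *v y"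
  shows "qf P (y + w) - b * (norm w)\<^sup>2 = y \<bullet> (P *v (y + L *v y)) - zform b P (w - L *v y)"
proof -
  define l where "l = L *v y"
  have s: "x \<bullet> (P *v z) = z \<bullet> (P *v x)" for x z
    using assms(1) by (simp add: selfadj_def)
  have bl: "b *\<^sub>R l = P *v l + P *v y"
    using L[of y] by (simp add: l_def algebra_simps)
  have 1: "b * (w \<bullet> l) = w \<bullet> (P *v l) + w \<bullet> (P *v y)"
    by (metis bl inner_add_right inner_scaleR_right)
  have 2: "b * (l \<bullet> l) = l \<bullet> (P *v l) + l \<bullet> (P *v y)"
    by (metis bl inner_add_right inner_scaleR_right)
  show ?thesis
    unfolding l_def[symmetric] zform_def power2_norm_eq_inner using 1 2 s[of y w] s[of y l] s[of l w]
    by (simp add: matrix_vector_right_distrib matrix_vector_mult_diff_distrib inner_add_left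
        inner_add_right inner_diff_left inner_diff_right algebra_simps inner_commute[of l w])
qed

text \<open>The identity behind both strategies: the stage payoff plus the change of the value is
  the loss of the controller from leaving its gain \<open>K\<close> minus the loss of the disturbance from
  leaving its gain \<open>L\<close>. It holds for arbitrary \<open>x\<close>, \<open>u\<close> and \<open>w\<close>, so it can be summed along any
  trajectory, however the controls and disturbances were generated.\<close>
theorem riccati_completion_of_squares:
  fixes A :: "real^'n^'n" and B :: "real^'m^'n" and C :: "real^'n^'p" and D :: "real^'m^'p"
  assumes "riccati_step A B C D b P L K P'" "selfadj P" "transpose C ** D = 0"
  shows "(norm (C *v x + D *v u))\<^sup>2 - b * (norm w)\<^sup>2 + qf P (A *v x + B *v u + w) =
    qf P' x + sform B D P L (u - K *v x) - zform b P (w - L *v (A *v x + B *v u))"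
proof -
  define k where "k = K *v x"
  define pa where "pa = (\<lambda>y. P *v (y + L *v y))"
  have L: "\<And>y. b *\<^sub>R (L *v y) - P *v (L *v y) = P *v y"
    and K: "\<And>u. (D *v u) \<bullet> (D *v k) + (B *v u) \<bullet> pa (B *v k) = - ((B *v u) \<bullet> pa (A *v x))"
    and P': "qf P' x = (A *v x) \<bullet> pa (A *v x) + (A *v x) \<bullet> pa (B *v k) + (norm (C *v x))\<^sup>2"
    using assms(1) by (auto simp: riccati_step_def pa_def k_def)
  have pa_sym: "y \<bullet> pa z = z \<bullet> pa y" for y z
    using gain_selfadj[OF assms(2) L, of y z] assms(2)
    by (simp add: pa_def matrix_vector_right_distrib inner_add_right selfadj_def)
  have pa_add: "pa (y + z) = pa y + pa z" and pa_diff: "pa (y - z) = pa y - pa z" for y z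
    by (simp_all add: pa_def matrix_vector_right_distrib matrix_vector_mult_diff_distrib)
  have "(C *v x) \<bullet> (D *v u) = x \<bullet> ((transpose C ** D) *v u)"
    by (simp add: inner_transpose_right del: transpose_matrix_vector flip: matrix_vector_mul_assoc)
  then have cd: "(C *v x) \<bullet> (D *v u) = 0"
    by (simp add: assms(3))
  have "qf P (A *v x + B *v u + w) - b * (norm w)\<^sup>2 =
      (A *v x + B *v u) \<bullet> pa (A *v x + B *v u) - zform b P (w - L *v (A *v x + B *v u))"
    using maximize_disturbance[OF assms(2) L] by (simp add: pa_def)
  moreover have "(norm (C *v x + D *v u))\<^sup>2 + (A *v x + B *v u) \<bullet> pa (A *v x + B *v u) =
      qf P' x + sform B D P L (u - K *v x)"
  proof -
    have "sform B D P L (u - k) = (norm (D *v (u - k)))\<^sup>2 + (B *v (u - k)) \<bullet> pa (B *v (u - k))"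
      by (simp add: sform_def pa_def)
    then show ?thesis
      unfolding k_def[symmetric] P' power2_norm_eq_inner
      using K[of u] K[of k] cd pa_sym[of "A *v x" "B *v u"] pa_sym[of "A *v x" "B *v k"]
        pa_sym[of "B *v u" "B *v k"]
      by (simp add: matrix_vector_right_distrib matrix_vector_mult_diff_distrib inner_add_left
          pa_add pa_diff inner_add_right inner_diff_left inner_diff_right algebra_simps
          inner_commute[of "D *v k" "D *v u"] inner_commute[of "D *v u" "C *v x"])
  qed
  ultimately show ?thesis
    by linarith
qed

lemma zform_ge: "(\<And>x. qf P x \<le> a * (norm x)\<^sup>2) \<Longrightarrow> (b - a) * (norm e)\<^sup>2 \<le> zform b P e"
  by (simp add: zform_def algebra_simps)

text \<open>Maximizing over the disturbance can only increase the value: \<open>P + P L \<ge> P \<ge> 0\<close>.\<close>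
lemma sform_ge:
  fixes P L :: "real^'n^'n"
  assumes "selfadj P" and L: "\<And>y. b *\<^sub>R (L *v y) - P *v (L *v y) = P *v y"
    and "\<And>x. 0 \<le> qf P x" "\<And>x. qf P x \<le> a * (norm x)\<^sup>2" "a \<le> b"
  shows "(norm (D *v u))\<^sup>2 \<le> sform B D P L u"
proof -
  define y where "y = B *v u"
  have "0 \<le> (b - a) * (norm (L *v y))\<^sup>2"
    using assms(5) by simp
  also have "\<dots> \<le> zform b P (L *v y)"
    by (rule zform_ge) (rule assms(4))
  also have "zform b P (0 - L *v y) = zform b P (L *v y)"
    by (simp add: zform_def matrix_vector_mult_diff_distrib[of P 0, simplified])
  then have "zform b P (L *v y) = y \<bullet> (P *v (y + L *v y)) - qf P y"
    using maximize_disturbance[OF assms(1) L, of y 0] by simp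
  finally show ?thesis
    using assms(3)[of y] by (simp add: sform_def y_def)
qed

lemma riccati_step_exists:
  fixes A :: "real^'n^'n" and B :: "real^'m^'n" and C :: "real^'n^'p" and D :: "real^'m^'p"
  assumes "selfadj P" "\<And>x. 0 \<le> qf P x" "\<And>x. qf P x \<le> a * (norm x)\<^sup>2" "a < b"
    and "pos_def (transpose D ** D)"
  obtains L K P' where "riccati_step A B C D b P L K P'" "selfadj P'"
proof -
  define L where "L = matrix_inv (mat b - P) ** P"
  have "0 < qf (mat b - P) x" if "x \<noteq> 0" for x
  proof -
    have "a * (norm x)\<^sup>2 < b * (norm x)\<^sup>2"
      using that assms(4) by simp
    then show ?thesis
      using assms(3)[of x]
      by (simp add: matrix_vector_mult_diff_rdistrib inner_diff_right mat_vector_mult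
          power2_norm_eq_inner)
  qed
  then have "invertible (mat b - P)"
    by (rule invertible_if_definite)
  then have L: "b *\<^sub>R (L *v y) - P *v (L *v y) = P *v y" for y
    using invertible_right_vector[of "mat b - P" "P *v y"]
    by (simp add: L_def matrix_vector_mult_diff_rdistrib mat_vector_mult
        flip: matrix_vector_mul_assoc)
  define Pa where "Pa = P + P ** L"
  have Pa: "Pa *v y = P *v (y + L *v y)" for y
    by (simp add: Pa_def matrix_vector_mult_add_rdistrib matrix_vector_right_distrib
        flip: matrix_vector_mul_assoc)
  have Pa_sym: "x \<bullet> (Pa *v y) = y \<bullet> (Pa *v x)" for x y
    using gain_selfadj[OF assms(1) L, of x y] assms(1)
    by (simp add: Pa matrix_vector_right_distrib inner_add_right selfadj_def)
  define S where "S = transpose D ** D + transpose B ** Pa ** B"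
  have S: "u \<bullet> (S *v u') = (D *v u) \<bullet> (D *v u') + (B *v u) \<bullet> (Pa *v (B *v u'))" for u u'
    by (simp add: S_def matrix_vector_mult_add_rdistrib inner_add_right inner_transpose_right
        del: transpose_matrix_vector
        flip: matrix_vector_mul_assoc)
  have "0 < qf S u" if "u \<noteq> 0" for u
  proof -
    have "0 < u \<bullet> ((transpose D ** D) *v u)"
      using assms(5) that by (simp add: pos_def_def)
    also have "\<dots> = (norm (D *v u))\<^sup>2"
      by (simp add: inner_transpose_right power2_norm_eq_inner del: transpose_matrix_vector flip: matrix_vector_mul_assoc)
    also have "\<dots> \<le> sform B D P L u"
      by (rule sform_ge[OF assms(1) L assms(2,3)]) (use assms(4) in auto)
    also have "\<dots> = qf S u"
      by (simp add: S sform_def Pa power2_norm_eq_inner)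
    finally show ?thesis .
  qed
  then have "invertible S"
    by (rule invertible_if_definite)
  define K where "K = - (matrix_inv S ** (transpose B ** Pa ** A))"
  have "S *v (K *v x) = - ((transpose B ** Pa ** A) *v x)" for x
    using invertible_right_vector[OF \<open>invertible S\<close>, of "- ((transpose B ** Pa ** A) *v x)"]
    by (simp add: K_def matrix_vector_mult_uminus vec.neg del: transpose_matrix_vector
        flip: matrix_vector_mul_assoc)
  then have K: "u \<bullet> (S *v (K *v x)) = - ((B *v u) \<bullet> (Pa *v (A *v x)))" for u x
    by (simp add: inner_transpose_right del: transpose_matrix_vector flip: matrix_vector_mul_assoc)
  define P' where "P' = transpose A ** Pa ** A + transpose A ** Pa ** B ** K + transpose C ** C"
  have P': "x \<bullet> (P' *v y) = (A *v x) \<bullet> (Pa *v (A *v y)) + (A *v x) \<bullet> (Pa *v (B *v (K *v y)))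
      + (C *v x) \<bullet> (C *v y)" for x y
    by (simp add: P'_def matrix_vector_mult_add_rdistrib inner_add_right inner_transpose_right
        del: transpose_matrix_vector
        flip: matrix_vector_mul_assoc)
  have "(A *v x) \<bullet> (Pa *v (B *v (K *v y))) = (A *v y) \<bullet> (Pa *v (B *v (K *v x)))" for x y
    using K[of "K *v x" y] K[of "K *v y" x] S[of "K *v x" "K *v y"] S[of "K *v y" "K *v x"]
    by (metis Pa_sym inner_commute neg_equal_iff_equal)
  then have "selfadj P'"
    by (simp add: selfadj_def P' inner_commute Pa_sym)
  moreover have "riccati_step A B C D b P L K P'"
    using L K P' unfolding riccati_step_def S Pa power2_norm_eq_inner by auto
  ultimately show thesis
    using that by blast
qed

text \<open>Compare both values at one pair of moves: the control optimal for \<open>Q\<close> keeps the payoff below \<open>Q'\<close>,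
  and the disturbance optimal for \<open>P\<close> keeps it above \<open>P'\<close>.\<close>
lemma riccati_step_mono:
  fixes A :: "real^'n^'n" and B :: "real^'m^'n" and C :: "real^'n^'p" and D :: "real^'m^'p"
  assumes "transpose C ** D = 0"
    and P: "riccati_step A B C D b P L K P'" "selfadj P" "\<And>u. 0 \<le> sform B D P L u"
    and Q: "riccati_step A B C D b Q M H Q'" "selfadj Q" "\<And>e. 0 \<le> zform b Q e"
    and le: "\<And>x. qf P x \<le> qf Q x"
  shows "qf P' x \<le> qf Q' x"
proof -
  define u where "u = H *v x"
  define y where "y = A *v x + B *v u"
  define w where "w = L *v y"
  have "qf P' x \<le> qf P' x + sform B D P L (u - K *v x) - zform b P (w - L *v y)"
    using P(3) by (simp add: w_def zform_def)
  also have "\<dots> = (norm (C *v x + D *v u))\<^sup>2 - b * (norm w)\<^sup>2 + qf P (y + w)"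
    using riccati_completion_of_squares[OF P(1,2) assms(1)] by (simp add: y_def)
  also have "\<dots> \<le> (norm (C *v x + D *v u))\<^sup>2 - b * (norm w)\<^sup>2 + qf Q (y + w)"
    using le by simp
  also have "\<dots> = qf Q' x + sform B D Q M (u - H *v x) - zform b Q (w - M *v y)"
    using riccati_completion_of_squares[OF Q(1,2) assms(1)] by (simp add: y_def)
  also have "\<dots> \<le> qf Q' x"
    using Q(3) by (simp add: u_def sform_def)
  finally show ?thesis .
qed

section \<open>The closed loop as a causal system\<close>

definition energy :: "(nat \<Rightarrow> real^'n) \<Rightarrow> nat \<Rightarrow> real" where
  "energy w T = (\<Sum>t<T. (norm (w t))\<^sup>2)"

lemma energy_nonneg: "0 \<le> energy w T"
  by (simp add: energy_def sum_nonneg)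

lemma energy_Suc: "energy w (Suc T) = energy w T + (norm (w T))\<^sup>2"
  by (simp add: energy_def)

lemma energy_mono: "S \<le> T \<Longrightarrow> energy w S \<le> energy w T"
  unfolding energy_def by (rule sum_mono2) auto

lemma energy_pos: "w 0 \<noteq> 0 \<Longrightarrow> 1 \<le> T \<Longrightarrow> 0 < energy w T"
  using energy_mono[of 1 T w] less_le_trans[of 0 "energy w 1" "energy w T"]
  by (simp add: energy_def)

lemma energy_cong: "(\<And>t. t < T \<Longrightarrow> w t = w' t) \<Longrightarrow> energy w T = energy w' T"
  by (simp add: energy_def)

lemma info_cong:
  assumes "\<And>k. k < j \<Longrightarrow> d (s + k) = d' (s + k)"
  shows "info A B \<mu>\<^sub>u \<mu>\<^sub>\<sigma> (\<lambda>k _. d k) s \<xi> j = info A B \<mu>\<^sub>u \<mu>\<^sub>\<sigma> (\<lambda>k _. d' k) s \<xi> j"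
  using assms by (induction j) (auto simp: Let_def)

lemma info_append:
  assumes "info A B \<mu>\<^sub>u \<mu>\<^sub>\<sigma> \<mu>\<^sub>w s \<xi> i = [\<xi>']"
  shows "info A B \<mu>\<^sub>u \<mu>\<^sub>\<sigma> \<mu>\<^sub>w s \<xi> (i + j) = info A B \<mu>\<^sub>u \<mu>\<^sub>\<sigma> \<mu>\<^sub>w (s + i) \<xi>' j"
  by (induction j) (simp_all add: assms Let_def add.assoc)

locale closed_loop =
  fixes A :: "real^'n^'n" and B :: "real^'m^'n"
    and C2 :: "real^'n^'p" and D21 :: "real^'m^'p"
    and \<mu>\<^sub>u :: "('n, 'm) controller" and \<mu>\<^sub>\<sigma> :: "'n scheduler"
begin

abbreviation "inf_set \<equiv> cl_info A B \<mu>\<^sub>u \<mu>\<^sub>\<sigma>"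
abbreviation "state \<equiv> cl_state A B \<mu>\<^sub>u \<mu>\<^sub>\<sigma>"
abbreviation "inp \<equiv> cl_input A B \<mu>\<^sub>u \<mu>\<^sub>\<sigma>"
abbreviation "sends \<equiv> cl_sigma A B \<mu>\<^sub>u \<mu>\<^sub>\<sigma>"
abbreviation "outp \<equiv> cl_output A B C2 D21 \<mu>\<^sub>u \<mu>\<^sub>\<sigma>"

lemma inf_set_cong:
  assumes "1 \<le> T" "\<And>t. t < T \<Longrightarrow> w t = w' t"
  shows "inf_set w T = inf_set w' T"
proof -
  have "w 0 = w' 0"
    using assms by auto
  then show ?thesis
    unfolding cl_info_def using assms(2) by (simp only:) (rule info_cong, auto)
qed

lemma causal:
  assumes "\<And>t. t < T \<Longrightarrow> w t = w' t"
  shows "state w T = state w' T" "inp w T = inp w' T" "sends w T = sends w' T"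
    "outp w T = outp w' T"
proof -
  have "T \<noteq> 0 \<Longrightarrow> inf_set w T = inf_set w' T"
    using inf_set_cong[of T w w'] assms by auto
  then show "state w T = state w' T" "inp w T = inp w' T" "sends w T = sends w' T"
      "outp w T = outp w' T"
    by (auto simp: cl_state_def cl_input_def cl_sigma_def cl_output_def)
qed

lemma sends_iff: "1 \<le> s \<Longrightarrow> sends w s \<longleftrightarrow> inf_set w s = [state w s]"
  by (auto simp: cl_sigma_def cl_state_def length_Suc_conv)

lemma inf_set_restart:
  assumes "1 \<le> s" "inf_set w s = [\<xi>]"
  shows "inf_set w (s + j) = info A B \<mu>\<^sub>u \<mu>\<^sub>\<sigma> (\<lambda>k _. w k) s \<xi> j"
  using info_append[of A B \<mu>\<^sub>u \<mu>\<^sub>\<sigma> "\<lambda>k _. w k" 1 "w 0" "s - 1" \<xi> j] assms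
  by (simp add: cl_info_def)

text \<open>After a transmission the loop remembers only the time and the transmitted state, whatever the
  disturbance did before. This is what allows an expensive past to be exchanged for a cheap one.\<close>
lemma inf_set_glue:
  assumes "1 \<le> s" "inf_set w s = [\<xi>]" "inf_set w' s = [\<xi>]"
    and "\<And>t. s \<le> t \<Longrightarrow> t < T \<Longrightarrow> w t = w' t" "s \<le> T"
  shows "inf_set w T = inf_set w' T"
proof -
  obtain j where T: "T = s + j"
    using assms(5) le_Suc_ex by blast
  show ?thesis
    unfolding T inf_set_restart[OF assms(1,2)] inf_set_restart[OF assms(1,3)]
    using assms(4) T by (auto intro!: info_cong)
qed

text \<open>Disturbances are signals, while strategies are feedback laws. Since the state and the input at
  time \<open>t\<close> depend only on the disturbance before \<open>t\<close>, a law used during \<open>N\<close> steps is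
  realized by a signal, fixed one value after the other.\<close>
lemma realize_feedback:
  fixes f :: "nat \<Rightarrow> real^'n \<Rightarrow> real^'m \<Rightarrow> real^'n"
  obtains w' where "\<And>t. t < s \<Longrightarrow> w' t = w t"
    "\<And>t. s \<le> t \<Longrightarrow> t < s + N \<Longrightarrow> w' t = f t (state w' t) (inp w' t)"
    "\<And>t. s + N \<le> t \<Longrightarrow> w' t = 0"
proof -
  have "\<exists>w'. (\<forall>t<s. w' t = w t) \<and> (\<forall>t. s \<le> t \<and> t < s + N \<longrightarrow> w' t = f t (state w' t) (inp w' t))
      \<and> (\<forall>t\<ge>s + N. w' t = 0)"
  proof (induction N)
    case 0
    show ?case
      by (rule exI[of _ "\<lambda>t. if t < s then w t else 0"]) auto
  next
    case (Suc N)
    then obtain w' where w': "\<forall>t<s. w' t = w t"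
      "\<And>t. s \<le> t \<Longrightarrow> t < s + N \<Longrightarrow> w' t = f t (state w' t) (inp w' t)" "\<forall>t\<ge>s + N. w' t = 0"
      by blast
    define w'' where "w'' = w'(s + N := f (s + N) (state w' (s + N)) (inp w' (s + N)))"
    have eq: "state w'' t = state w' t" "inp w'' t = inp w' t" if "t \<le> s + N" for t
      using causal(1,2)[of t w'' w'] that by (auto simp: w''_def)
    show ?case
    proof (intro exI[of _ w''] conjI allI impI)
      fix t
      assume "s \<le> t \<and> t < s + Suc N"
      then show "w'' t = f t (state w'' t) (inp w'' t)"
        using eq[of t] w'(2)[of t] by (cases "t = s + N") (auto simp: w''_def)
    qed (use w' in \<open>auto simp: w''_def\<close>)
  qed
  then show thesis
    using that by blast
qed

end

text \<open>The gap between \<open>\<gamma>\<^sup>2\<close> and \<open>b\<close> keeps \<open>b I - P\<close> uniformly positive along the Riccati iteration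
  for \<open>b\<close>.\<close>
locale attenuating_loop = closed_loop A B C2 D21 \<mu>\<^sub>u \<mu>\<^sub>\<sigma>
  for A :: "real^'n^'n" and B :: "real^'m^'n"
    and C2 :: "real^'n^'p" and D21 :: "real^'m^'p"
    and \<mu>\<^sub>u :: "('n, 'm) controller" and \<mu>\<^sub>\<sigma> :: "'n scheduler" +
  fixes \<gamma> b :: real
  assumes orth: "transpose C2 ** D21 = 0"
    and R_pos: "pos_def (transpose D21 ** D21)"
    and b_gt: "\<gamma>\<^sup>2 < b"
    and attenuates: "\<And>w. w \<in> ell2 \<Longrightarrow> w 0 \<noteq> 0 \<Longrightarrow> sqnorm (outp w) \<le> ennreal (\<gamma>\<^sup>2) * sqnorm w"
begin

lemma attenuates_finite:
  assumes "w 0 \<noteq> 0" and z: "\<And>t. T \<le> t \<Longrightarrow> w t = 0"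
  shows "(\<Sum>t<M. (norm (outp w t))\<^sup>2) \<le> \<gamma>\<^sup>2 * energy w T"
proof -
  have "w \<in> ell2"
    unfolding ell2_def using z by (auto intro!: summable_finite[of "{..<T}"]) (meson not_le)
  have "sqnorm w = (\<Sum>t<T. ennreal ((norm (w t))\<^sup>2))"
    unfolding sqnorm_def using z by (intro suminf_finite) (auto simp: not_less)
  also have "\<dots> = ennreal (energy w T)"
    by (simp add: energy_def)
  finally have w: "sqnorm w = ennreal (energy w T)" .
  have "ennreal (\<Sum>t<M. (norm (outp w t))\<^sup>2) = (\<Sum>t<M. ennreal ((norm (outp w t))\<^sup>2))"
    by simp
  also have "\<dots> \<le> sqnorm (outp w)"
    unfolding sqnorm_def by (rule sum_le_suminf) auto
  also have "\<dots> \<le> ennreal (\<gamma>\<^sup>2) * ennreal (energy w T)"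
    using attenuates[OF \<open>w \<in> ell2\<close> assms(1)] by (simp add: w)
  also have "\<dots> = ennreal (\<gamma>\<^sup>2 * energy w T)"
    by (simp add: ennreal_mult energy_nonneg)
  finally show ?thesis
    by (simp add: energy_nonneg)
qed

lemma norm_output: "(norm (outp w t))\<^sup>2 = (norm (C2 *v state w t))\<^sup>2 + (norm (D21 *v inp w t))\<^sup>2"
proof -
  have "(C2 *v state w t) \<bullet> (D21 *v inp w t) = state w t \<bullet> ((transpose C2 ** D21) *v inp w t)"
    by (simp add: inner_transpose_right del: transpose_matrix_vector flip: matrix_vector_mul_assoc)
  then show ?thesis
    by (simp add: orth cl_output_def power2_norm_eq_inner inner_add_left inner_add_right
        inner_commute)
qed

text \<open>Stop the disturbance just before time \<open>t\<close>. The input at time \<open>t\<close> is not affected, and it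
  contributes at least \<open>|D\<^sub>2\<^sub>1 u|\<^sup>2\<close> to an output energy that is bounded by the disturbance
  energy spent before \<open>t\<close>.\<close>
lemma input_bound:
  obtains c where "0 < c" "\<And>w t. w 0 \<noteq> 0 \<Longrightarrow> norm (inp w t) \<le> c * sqrt (energy w t)"
proof -
  obtain c where c: "0 < c" "\<And>u. norm u \<le> c * norm (D21 *v u)"
    using pos_def_bounded_below[OF R_pos] by blast
  have "norm (inp w t) \<le> (c * (\<bar>\<gamma>\<bar> + 1)) * sqrt (energy w t)" if "w 0 \<noteq> 0" for w t
  proof (cases "t = 0")
    case True
    then show ?thesis
      using c(1) by (simp add: cl_input_0 energy_nonneg)
  next
    case False
    define w' where "w' = (\<lambda>k. if k < t then w k else 0)"
    have "(norm (D21 *v inp w t))\<^sup>2 \<le> (norm (outp w' t))\<^sup>2"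
      using causal(4)[of t w' w] by (simp add: norm_output w'_def)
    also have "\<dots> \<le> (\<Sum>k<Suc t. (norm (outp w' k))\<^sup>2)"
      by (simp add: sum_nonneg)
    also have "\<dots> \<le> \<gamma>\<^sup>2 * energy w' t"
      using that False by (intro attenuates_finite) (auto simp: w'_def)
    also have "\<dots> = \<gamma>\<^sup>2 * energy w t"
      using energy_cong[of t w' w] by (simp add: w'_def)
    finally have "norm (D21 *v inp w t) \<le> sqrt (\<gamma>\<^sup>2 * energy w t)"
      by (rule real_le_rsqrt)
    also have "\<dots> = \<bar>\<gamma>\<bar> * sqrt (energy w t)"
      by (simp add: real_sqrt_mult)
    also have "\<dots> \<le> (\<bar>\<gamma>\<bar> + 1) * sqrt (energy w t)"
      by (intro mult_right_mono) (auto simp: energy_nonneg)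
    finally have "c * norm (D21 *v inp w t) \<le> c * ((\<bar>\<gamma>\<bar> + 1) * sqrt (energy w t))"
      using c(1) by simp
    then show ?thesis
      using c(2)[of "inp w t"] by (simp add: mult.assoc)
  qed
  then show thesis
    using c(1) by (intro that[of "c * (\<bar>\<gamma>\<bar> + 1)"]) auto
qed

section \<open>Values that the disturbance can secure\<close>

definition payoff :: "(nat \<Rightarrow> real^'n) \<Rightarrow> nat \<Rightarrow> real" where
  "payoff w t = (norm (outp w t))\<^sup>2 - b * (norm (w t))\<^sup>2"

text \<open>A lower bound on the value of the game against the given loop. The continuations are finite so that the
  resulting signals lie in \<open>\<ell>\<^sub>2\<close>; the output energy that follows them is left out of account.\<close>
definition secures :: "real^'n^'n \<Rightarrow> bool" where
  "secures P \<longleftrightarrow> (\<forall>w s. 1 \<le> s \<longrightarrow> (\<exists>w' T. (\<forall>t<s. w' t = w t) \<and> s \<le> T \<and> (\<forall>t\<ge>T. w' t = 0) \<and>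
     qf P (state w s) \<le> sum (payoff w') {s..<T}))"

lemma secures_0: "secures 0"
  unfolding secures_def
proof (intro allI impI)
  fix w :: "nat \<Rightarrow> real^'n" and s :: nat
  show "\<exists>w' T. (\<forall>t<s. w' t = w t) \<and> s \<le> T \<and> (\<forall>t\<ge>T. w' t = 0) \<and>
      qf 0 (state w s) \<le> sum (payoff w') {s..<T}"
    by (intro exI[of _ "\<lambda>t. if t < s then w t else 0"] exI[of _ s]) auto
qed

lemma payoff_cong: "(\<And>k. k \<le> t \<Longrightarrow> w k = w' k) \<Longrightarrow> payoff w t = payoff w' t"
  using causal(4)[of t w w'] by (auto simp: payoff_def)

text \<open>Prolong the disturbance by a continuation that secures \<open>qf P\<close>; the attenuation bound then applies to
  the whole, finitely supported, signal. Using \<open>\<gamma>\<^sup>2\<close> in place of \<open>b\<close> leaves a multiple of the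
  energy to spare.\<close>
lemma secures_budget:
  assumes "secures P" "w 0 \<noteq> 0" "1 \<le> T"
  shows "sum (payoff w) {..<T} + qf P (state w T) \<le> - (b - \<gamma>\<^sup>2) * energy w T"
proof -
  obtain w' S where w': "\<And>t. t < T \<Longrightarrow> w' t = w t" "T \<le> S" "\<And>t. S \<le> t \<Longrightarrow> w' t = 0"
    "qf P (state w T) \<le> sum (payoff w') {T..<S}"
    using assms(1)[unfolded secures_def, rule_format, OF assms(3), of w] by blast
  have "sum (payoff w) {..<T} = sum (payoff w') {..<T}"
    using w'(1) by (intro sum.cong payoff_cong) auto
  then have "sum (payoff w) {..<T} + qf P (state w T) \<le> sum (payoff w') {..<T} + sum (payoff w') {T..<S}"
    using w'(4) by simp
  also have "\<dots> = sum (payoff w') {..<S}"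
    using w'(2) by (simp add: lessThan_atLeast0 sum.atLeastLessThan_concat)
  also have "\<dots> = (\<Sum>t<S. (norm (outp w' t))\<^sup>2) - b * energy w' S"
    by (simp add: payoff_def energy_def sum_subtractf sum_distrib_left)
  also have "\<dots> \<le> \<gamma>\<^sup>2 * energy w' S - b * energy w' S"
    using w' assms(2,3) by (intro diff_right_mono attenuates_finite) auto
  also have "\<dots> = - ((b - \<gamma>\<^sup>2) * energy w' S)"
    by (simp add: algebra_simps)
  also have "\<dots> \<le> - ((b - \<gamma>\<^sup>2) * energy w' T)"
    using b_gt energy_mono[OF w'(2)] by simp
  also have "energy w' T = energy w T"
    using w'(1) by (rule energy_cong)
  finally show ?thesis
    by (simp only: mult_minus_left)
qed

lemma state_1: "state w 1 = w 0"
  by (simp add: cl_state_def cl_info_def)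

lemma payoff_0: "payoff w 0 = - b * (norm (w 0))\<^sup>2"
  by (simp add: payoff_def cl_output_def cl_state_0 cl_input_0)

text \<open>The budget at time 1, where the state is the first value of the disturbance.\<close>
lemma secures_le:
  assumes "secures P"
  shows "qf P x \<le> \<gamma>\<^sup>2 * (norm x)\<^sup>2"
proof (cases "x = 0")
  case False
  then show ?thesis
    using secures_budget[OF assms, of "\<lambda>_. x" 1] state_1[of "\<lambda>_. x"]
    by (simp add: payoff_0 energy_def algebra_simps lessThan_Suc)
qed simp

text \<open>Play \<open>L\<close> for one step; the control can only lose by leaving its gain \<open>K\<close>.\<close>
lemma secures_step:
  assumes "secures P" "riccati_step A B C2 D21 b P L K P'" "selfadj P" "\<And>x. 0 \<le> qf P x"
  shows "secures P'"
  unfolding secures_def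
proof (intro allI impI)
  fix w :: "nat \<Rightarrow> real^'n" and s :: nat
  assume s: "1 \<le> s"
  define v where "v = w(s := L *v (A *v state w s + B *v inp w s))"
  obtain w' T where w': "\<And>t. t < Suc s \<Longrightarrow> w' t = v t" "Suc s \<le> T" "\<And>t. T \<le> t \<Longrightarrow> w' t = 0"
    "qf P (state v (Suc s)) \<le> sum (payoff w') {Suc s..<T}"
    using assms(1)[unfolded secures_def, rule_format, of "Suc s" v] by auto
  have "state v s = state w s" "inp v s = inp w s" "outp v s = outp w s"
    using causal(1,2,4)[of s v w] by (auto simp: v_def)
  moreover have "payoff w' s = payoff v s"
    using w'(1) by (intro payoff_cong) auto
  moreover have "0 \<le> sform B D21 P L (inp w s - K *v state w s)"
  proof -
    have "\<And>y. b *\<^sub>R (L *v y) - P *v (L *v y) = P *v y"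
      using assms(2) by (simp add: riccati_step_def)
    then show ?thesis
      using sform_ge[OF assms(3) _ assms(4) secures_le[OF assms(1)], of b L D21 "inp w s - K *v state w s" B] b_gt
      by (meson less_imp_le order_trans zero_le_power2)
  qed
  ultimately have "qf P' (state w s) \<le> payoff w' s + qf P (state v (Suc s))"
    using riccati_completion_of_squares[OF assms(2,3) orth, of "state w s" "inp w s" "v s"]
    by (simp add: payoff_def cl_output_def cl_state_Suc v_def zform_def)
  also have "\<dots> \<le> payoff w' s + sum (payoff w') {Suc s..<T}"
    using w'(4) by simp
  also have "\<dots> = sum (payoff w') {s..<T}"
    using w'(2) by (simp add: sum.atLeast_Suc_lessThan)
  finally show "\<exists>w' T. (\<forall>t<s. w' t = w t) \<and> s \<le> T \<and> (\<forall>t\<ge>T. w' t = 0) \<and>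
      qf P' (state w s) \<le> sum (payoff w') {s..<T}"
    using w'(1-3) by (intro exI[of _ w'] exI[of _ T]) (auto simp: v_def)
qed

section \<open>The solution of the Riccati equation\<close>

lemma zform_nonneg: "(\<And>x. qf P x \<le> \<gamma>\<^sup>2 * (norm x)\<^sup>2) \<Longrightarrow> 0 \<le> zform b P e"
  using zform_ge[of P "\<gamma>\<^sup>2" b e] b_gt
  by (meson diff_ge_0_iff_ge less_imp_le mult_nonneg_nonneg order_trans zero_le_power2)

text \<open>This bound and the next one make the gains of the Riccati iteration range over a bounded set, so that
  they have a convergent subsequence.\<close>
lemma gain_bound:
  assumes "selfadj P" "\<And>x. 0 \<le> qf P x" "\<And>x. qf P x \<le> \<gamma>\<^sup>2 * (norm x)\<^sup>2"
    and L: "\<And>y. b *\<^sub>R (L *v y) - P *v (L *v y) = P *v y"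
  shows "norm (L *v y) \<le> \<gamma>\<^sup>2 / (b - \<gamma>\<^sup>2) * norm y"
proof -
  define l where "l = L *v y"
  have "(b - \<gamma>\<^sup>2) * (norm l)\<^sup>2 \<le> zform b P l"
    by (rule zform_ge) (rule assms(3))
  also have "\<dots> = l \<bullet> (b *\<^sub>R l - P *v l)"
    by (simp add: zform_def power2_norm_eq_inner inner_diff_right)
  also have "\<dots> = l \<bullet> (P *v y)"
    by (simp add: l_def L)
  also have "\<dots> \<le> norm l * norm (P *v y)"
    by (rule norm_cauchy_schwarz)
  also have "\<dots> \<le> norm l * (\<gamma>\<^sup>2 * norm y)"
    by (intro mult_left_mono selfadj_norm_le assms) auto
  finally have "norm l * ((b - \<gamma>\<^sup>2) * norm l) \<le> norm l * (\<gamma>\<^sup>2 * norm y)"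
    by (simp add: power2_eq_square algebra_simps)
  then have "(b - \<gamma>\<^sup>2) * norm l \<le> \<gamma>\<^sup>2 * norm y"
    by (cases "l = 0") auto
  then show ?thesis
    using b_gt by (simp add: l_def field_simps)
qed

text \<open>Compare with the disturbance \<open>w = 0\<close>, which earns at most the value \<open>P'\<close> against the gain \<open>K\<close>.\<close>
lemma controller_gain_bound:
  assumes step: "riccati_step A B C2 D21 b P L K P'" and P: "selfadj P" "\<And>x. 0 \<le> qf P x"
    and le: "\<And>x. qf P x \<le> \<gamma>\<^sup>2 * (norm x)\<^sup>2"
  shows "(norm (D21 *v (K *v x)))\<^sup>2 \<le> qf P' x"
proof -
  define w where "w = L *v (A *v x + B *v (K *v x))"
  have z: "0 \<le> zform b P (0 - w)"
    by (rule zform_nonneg) (rule le)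
  have "(C2 *v x) \<bullet> (D21 *v (K *v x)) = x \<bullet> ((transpose C2 ** D21) *v (K *v x))"
    by (simp add: inner_transpose_right del: transpose_matrix_vector flip: matrix_vector_mul_assoc)
  then have "(norm (D21 *v (K *v x)))\<^sup>2 \<le> (norm (C2 *v x + D21 *v (K *v x)))\<^sup>2"
    by (simp add: orth power2_norm_eq_inner inner_add_left inner_add_right inner_commute)
  moreover have "(norm (C2 *v x + D21 *v (K *v x)))\<^sup>2 + qf P (A *v x + B *v (K *v x)) =
      qf P' x - zform b P (0 - w)"
    using riccati_completion_of_squares[OF step P(1) orth, of x "K *v x" 0]
    by (simp add: w_def sform_def)
  ultimately show ?thesis
    using z P(2)[of "A *v x + B *v (K *v x)"] by linarith
qed

lemma riccati_iteration:
  obtains P L K where "P 0 = 0" "\<And>n. riccati_step A B C2 D21 b (P n) (L n) (K n) (P (Suc n))"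
    "\<And>n. selfadj (P n)" "\<And>n x. 0 \<le> qf (P n) x" "\<And>n. secures (P n)"
proof -
  define Q where "Q = (\<lambda>n::nat. \<lambda>P. selfadj P \<and> (\<forall>x. 0 \<le> qf P x) \<and> secures P \<and> (n = 0 \<longrightarrow> P = 0))"
  have "\<exists>P. \<forall>n. Q n (P n) \<and> (\<exists>L K. riccati_step A B C2 D21 b (P n) L K (P (Suc n)))"
  proof (rule dependent_nat_choice)
    show "\<exists>P. Q 0 P"
      using secures_0 by (auto simp: Q_def selfadj_def)
  next
    fix P n
    assume "Q n P"
    then have P: "selfadj P" "\<And>x. 0 \<le> qf P x" "secures P"
      by (auto simp: Q_def)
    obtain L K P' where step: "riccati_step A B C2 D21 b P L K P'" "selfadj P'"
      using riccati_step_exists[OF P(1,2) secures_le[OF P(3)] b_gt R_pos] by blast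
    have "0 \<le> qf P' x" for x
      using controller_gain_bound[OF step(1) P(1,2) secures_le[OF P(3)], of x]
      by (meson order_trans zero_le_power2)
    moreover have "secures P'"
      using secures_step[OF P(3) step(1) P(1,2)] .
    ultimately show "\<exists>P'. Q (Suc n) P' \<and> (\<exists>L K. riccati_step A B C2 D21 b P L K P')"
      using step by (auto simp: Q_def)
  qed
  then obtain P where P: "\<And>n. Q n (P n)"
    "\<And>n. \<exists>L K. riccati_step A B C2 D21 b (P n) L K (P (Suc n))"
    by blast
  from P(2) obtain L K where "\<And>n. riccati_step A B C2 D21 b (P n) (L n) (K n) (P (Suc n))"
    by metis
  with P(1) show thesis
    by (intro that[of P L K]) (auto simp: Q_def)
qed

lemma sform_nonneg:
  assumes "riccati_step A B C2 D21 b P L K P'" "selfadj P" "\<And>x. 0 \<le> qf P x"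
    and "\<And>x. qf P x \<le> \<gamma>\<^sup>2 * (norm x)\<^sup>2"
  shows "0 \<le> sform B D21 P L u"
proof -
  have "\<And>y. b *\<^sub>R (L *v y) - P *v (L *v y) = P *v y"
    using assms(1) by (simp add: riccati_step_def)
  then show ?thesis
    using sform_ge[OF assms(2) _ assms(3,4), of b L D21 u B] b_gt
    by (meson less_imp_le order_trans zero_le_power2)
qed

text \<open>The quadratic forms of the iterates increase and are bounded by \<open>\<gamma>\<^sup>2 I\<close>, hence converge. The gains converge
  along a subsequence, and the Riccati relations pass to that limit. The budget inequality of the
  iterates survives as well: the limit \<open>P\<close> is a value that the disturbance can secure up to an
  arbitrarily small error.\<close>
theorem riccati_solution:
  obtains P L K where "riccati_step A B C2 D21 b P L K P" "selfadj P" "\<And>x. 0 \<le> qf P x"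
    "\<And>x. qf P x \<le> \<gamma>\<^sup>2 * (norm x)\<^sup>2"
    "\<And>w T. w 0 \<noteq> 0 \<Longrightarrow> 1 \<le> T \<Longrightarrow> sum (payoff w) {..<T} + qf P (state w T) \<le> 0"
proof -
  obtain P L K where P: "P 0 = 0" "\<And>n. riccati_step A B C2 D21 b (P n) (L n) (K n) (P (Suc n))"
    "\<And>n. selfadj (P n)" "\<And>n x. 0 \<le> qf (P n) x" "\<And>n. secures (P n)"
    using riccati_iteration by blast
  have le: "qf (P n) x \<le> \<gamma>\<^sup>2 * (norm x)\<^sup>2" for n x
    by (rule secures_le[OF P(5)])
  have gain: "\<And>n y. b *\<^sub>R (L n *v y) - P n *v (L n *v y) = P n *v y"
    using P(2) by (simp add: riccati_step_def)
  have mono: "qf (P n) x \<le> qf (P (Suc n)) x" for n x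
  proof (induction n arbitrary: x)
    case 0
    show ?case
      using P(1,4) by simp
  next
    case (Suc n)
    show ?case
      by (rule riccati_step_mono[OF orth P(2)[of n] P(3) sform_nonneg[OF P(2,3,4) le]
            P(2)[of "Suc n"] P(3) zform_nonneg[OF le] Suc.IH])
  qed
  obtain c where c: "0 < c" "\<And>u. norm u \<le> c * norm (D21 *v u)"
    using pos_def_bounded_below[OF R_pos] by blast
  have "norm (K n *v x) \<le> c * \<bar>\<gamma>\<bar> * norm x" for n x
  proof -
    have "(norm (D21 *v (K n *v x)))\<^sup>2 \<le> (\<bar>\<gamma>\<bar> * norm x)\<^sup>2"
      using controller_gain_bound[OF P(2)[of n] P(3,4) le, of x] le[where n = "Suc n" and x = x]
      by (simp add: power_mult_distrib)
    then have "norm (D21 *v (K n *v x)) \<le> \<bar>\<gamma>\<bar> * norm x"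
      by (rule power2_le_imp_le) simp
    then have "c * norm (D21 *v (K n *v x)) \<le> c * (\<bar>\<gamma>\<bar> * norm x)"
      using c(1) by simp
    then show ?thesis
      using c(2)[of "K n *v x"] by (simp add: mult.assoc)
  qed
  then have "bounded (range K)"
    by (rule bounded_matrices)
  moreover have "bounded (range L)"
    by (rule bounded_matrices, rule gain_bound[OF P(3,4) le gain])
  moreover have "bounded (range P)"
    by (rule bounded_matrices, rule selfadj_norm_le[OF P(3,4) le]) simp
  ultimately have "bounded (range P \<times> (range L \<times> range K))"
    by (intro bounded_Times)
  then have "bounded (range (\<lambda>n. (P n, L n, K n)))"
    by (rule bounded_subset) auto
  then obtain l r where r: "strict_mono r" "((\<lambda>n. (P n, L n, K n)) \<circ> r) \<longlonglongrightarrow> l"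
    using bounded_imp_convergent_subsequence by blast
  define P' L' K' where "P' = fst l" and "L' = fst (snd l)" and "K' = snd (snd l)"
  have lim: "(\<lambda>n. P (r n)) \<longlonglongrightarrow> P'" "(\<lambda>n. L (r n)) \<longlonglongrightarrow> L'" "(\<lambda>n. K (r n)) \<longlonglongrightarrow> K'"
    using tendsto_fst[OF r(2)] tendsto_fst[OF tendsto_snd[OF r(2)]]
      tendsto_snd[OF tendsto_snd[OF r(2)]]
    by (simp_all add: P'_def L'_def K'_def)
  have limP: "(\<lambda>n. qf (P n) x) \<longlonglongrightarrow> qf P' x" for x
  proof -
    have "incseq (\<lambda>n. qf (P n) x)"
      by (rule incseq_SucI) (rule mono)
    then obtain q where q: "(\<lambda>n. qf (P n) x) \<longlonglongrightarrow> q"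
      by (rule incseq_convergent) (use le in blast)
    then have "((\<lambda>n. qf (P n) x) \<circ> r) \<longlonglongrightarrow> q"
      by (rule LIMSEQ_subseq_LIMSEQ) (rule r(1))
    moreover have "(\<lambda>n. qf (P (r n)) x) \<longlonglongrightarrow> qf P' x"
      by (intro tendsto_intros tendsto_matrix_vector_mult lim)
    ultimately have "q = qf P' x"
      by (intro LIMSEQ_unique) (auto simp: o_def)
    with q show ?thesis
      by simp
  qed
  have "riccati_step A B C2 D21 b P' L' K' P'"
    unfolding riccati_step_def
  proof (intro conjI allI)
    fix x
    show "b *\<^sub>R (L' *v x) - P' *v (L' *v x) = P' *v x"
    proof (rule LIMSEQ_unique)
      show "(\<lambda>n. P (r n) *v x) \<longlonglongrightarrow> P' *v x"
        by (intro tendsto_intros tendsto_matrix_vector_mult lim)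
      have "(\<lambda>n. b *\<^sub>R (L (r n) *v x) - P (r n) *v (L (r n) *v x)) \<longlonglongrightarrow>
          b *\<^sub>R (L' *v x) - P' *v (L' *v x)"
        by (intro tendsto_intros tendsto_matrix_vector_mult lim)
      then show "(\<lambda>n. P (r n) *v x) \<longlonglongrightarrow> b *\<^sub>R (L' *v x) - P' *v (L' *v x)"
        by (simp add: gain)
    qed
  next
    fix u :: "real^'m" and x :: "real^'n"
    let ?l = "\<lambda>P L K. (D21 *v u) \<bullet> (D21 *v (K *v x)) +
      (B *v u) \<bullet> (P *v (B *v (K *v x) + L *v (B *v (K *v x))))"
    let ?r = "\<lambda>P L. - ((B *v u) \<bullet> (P *v (A *v x + L *v (A *v x))))"
    show "?l P' L' K' = ?r P' L'"
    proof (rule LIMSEQ_unique)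
      show "(\<lambda>n. ?r (P (r n)) (L (r n))) \<longlonglongrightarrow> ?r P' L'"
        by (intro tendsto_intros tendsto_matrix_vector_mult lim)
      have "(\<lambda>n. ?l (P (r n)) (L (r n)) (K (r n))) \<longlonglongrightarrow> ?l P' L' K'"
        by (intro tendsto_intros tendsto_matrix_vector_mult lim)
      moreover have "?l (P n) (L n) (K n) = ?r (P n) (L n)" for n
        using P(2)[of n] unfolding riccati_step_def by blast
      ultimately show "(\<lambda>n. ?r (P (r n)) (L (r n))) \<longlonglongrightarrow> ?l P' L' K'"
        by simp
    qed
  next
    fix x :: "real^'n"
    let ?r = "\<lambda>P L K. (A *v x) \<bullet> (P *v (A *v x + L *v (A *v x)))
        + (A *v x) \<bullet> (P *v (B *v (K *v x) + L *v (B *v (K *v x)))) + (norm (C2 *v x))\<^sup>2"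
    show "qf P' x = ?r P' L' K'"
    proof (rule LIMSEQ_unique)
      show "(\<lambda>n. ?r (P (r n)) (L (r n)) (K (r n))) \<longlonglongrightarrow> ?r P' L' K'"
        by (intro tendsto_intros tendsto_matrix_vector_mult lim)
      have "((\<lambda>n. qf (P (Suc n)) x) \<circ> r) \<longlonglongrightarrow> qf P' x"
        by (intro LIMSEQ_subseq_LIMSEQ r(1) LIMSEQ_Suc limP)
      moreover have "qf (P (Suc n)) x = ?r (P n) (L n) (K n)" for n
        using P(2)[of n] unfolding riccati_step_def by blast
      ultimately show "(\<lambda>n. ?r (P (r n)) (L (r n)) (K (r n))) \<longlonglongrightarrow> qf P' x"
        by (simp add: o_def)
    qed
  qed
  moreover have "selfadj P'"
    unfolding selfadj_def
  proof (intro allI)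
    fix x y
    have "(\<lambda>n. x \<bullet> (P (r n) *v y)) \<longlonglongrightarrow> x \<bullet> (P' *v y)" for x y
      by (intro tendsto_intros tendsto_matrix_vector_mult lim)
    moreover have "x \<bullet> (P n *v y) = y \<bullet> (P n *v x)" for n
      using P(3)[of n] by (simp add: selfadj_def)
    ultimately show "x \<bullet> (P' *v y) = y \<bullet> (P' *v x)"
      by (metis (no_types, lifting) LIMSEQ_unique ext)
  qed
  moreover have "0 \<le> qf P' x" for x
    by (rule LIMSEQ_le_const[OF limP]) (auto simp: P(4))
  moreover have "qf P' x \<le> \<gamma>\<^sup>2 * (norm x)\<^sup>2" for x
    by (rule LIMSEQ_le_const2[OF limP]) (auto simp: le)
  moreover have "sum (payoff w) {..<T} + qf P' (state w T) \<le> 0" if "w 0 \<noteq> 0" "1 \<le> T" for w T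
  proof (rule LIMSEQ_le_const2)
    show "(\<lambda>n. sum (payoff w) {..<T} + qf (P n) (state w T)) \<longlonglongrightarrow>
        sum (payoff w) {..<T} + qf P' (state w T)"
      by (intro tendsto_intros limP)
    have "0 \<le> (b - \<gamma>\<^sup>2) * energy w T"
      using b_gt energy_nonneg by (intro mult_nonneg_nonneg) auto
    then have "sum (payoff w) {..<T} + qf (P n) (state w T) \<le> 0" for n
      using secures_budget[of "P n" w T, OF P(5) that] by (simp only: mult_minus_left)
    then show "\<exists>N. \<forall>n\<ge>N. sum (payoff w) {..<T} + qf (P n) (state w T) \<le> 0"
      by blast
  qed
  ultimately show thesis
    using that by blast
qed

end

section \<open>Deviations from the saddle point\<close>

text \<open>Against a fixed open-loop control, a disturbance that adds \<open>e j\<close> to its gain \<open>L\<close> moves the state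
  away from the trajectory of the pure gain by this amount.\<close>
primrec deviation :: "real^'n^'n \<Rightarrow> real^'n^'n \<Rightarrow> (nat \<Rightarrow> real^'n) \<Rightarrow> nat \<Rightarrow> real^'n" where
  "deviation A L e 0 = 0"
| "deviation A L e (Suc j) = A *v deviation A L e j + L *v (A *v deviation A L e j) + e j"

text \<open>What such a deviation earns in \<open>N\<close> steps against a controller that keeps following the pure-gain
  trajectory.\<close>
definition deviation_gain :: "real^'n^'n \<Rightarrow> real^'m^'n \<Rightarrow> real^'m^'p \<Rightarrow> real \<Rightarrow> real^'n^'n \<Rightarrow>
    real^'n^'n \<Rightarrow> real^'n^'m \<Rightarrow> (nat \<Rightarrow> real^'n) \<Rightarrow> nat \<Rightarrow> real" where
  "deviation_gain A B D b P L K e N =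
     (\<Sum>j<N. sform B D P L (K *v deviation A L e j) - zform b P (e j))"

lemma sform_scaleR: "sform B D P L (c *\<^sub>R u) = c\<^sup>2 * sform B D P L u"
  by (simp add: sform_def matrix_vector_mult_scaleR power_mult_distrib power2_eq_square algebra_simps
      flip: scaleR_right_distrib)

lemma sform_minus: "sform B D P L (- u) = sform B D P L u"
  using sform_scaleR[of B D P L "-1" u] by simp

lemma zform_scaleR: "zform b P (c *\<^sub>R e) = c\<^sup>2 * zform b P e"
  by (simp add: zform_def matrix_vector_mult_scaleR power_mult_distrib power2_eq_square algebra_simps)

lemma sform_parallelogram:
  "sform B D P L (u + u') + sform B D P L (u - u') = 2 * sform B D P L u + 2 * sform B D P L u'"
  by (simp add: sform_def power2_norm_eq_inner matrix_vector_right_distrib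
      matrix_vector_mult_diff_distrib inner_add_left inner_add_right inner_diff_left
      inner_diff_right algebra_simps)

section \<open>A periodic controller that follows the saddle trajectory\<close>

text \<open>The controller's prediction of the state from the last transmitted one, if both players use their gains.\<close>
primrec saddle_state :: "real^'n^'n \<Rightarrow> real^'m^'n \<Rightarrow> real^'n^'n \<Rightarrow> real^'n^'m \<Rightarrow> real^'n \<Rightarrow> nat \<Rightarrow> real^'n" where
  "saddle_state A B L K \<xi> 0 = \<xi>"
| "saddle_state A B L K \<xi> (Suc j) =
     (let y = A *v saddle_state A B L K \<xi> j + B *v (K *v saddle_state A B L K \<xi> j) in y + L *v y)"

lemma info_periodic_within:
  assumes "j < N"
  shows "length (info A B \<mu>\<^sub>u (\<lambda>k _. N dvd k) \<mu>\<^sub>w (m * N) \<xi> j) = Suc j \<and>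
    hd (info A B \<mu>\<^sub>u (\<lambda>k _. N dvd k) \<mu>\<^sub>w (m * N) \<xi> j) = \<xi>"
  using assms
proof (induction j)
  case (Suc j)
  have "\<not> N dvd m * N + Suc j"
    using Suc.prems by (metis dvd_add_right_iff dvd_triv_right nat_dvd_not_less zero_less_Suc)
  then show ?case
    using Suc info_nonempty[of A B \<mu>\<^sub>u "\<lambda>k _. N dvd k" \<mu>\<^sub>w "m * N" \<xi> j] by (auto simp: Let_def)
qed simp

lemma info_periodic_at:
  assumes "1 \<le> N"
  shows "info A B \<mu>\<^sub>u (\<lambda>k _. N dvd k) \<mu>\<^sub>w 0 \<xi> (m * N) =
    [last (info A B \<mu>\<^sub>u (\<lambda>k _. N dvd k) \<mu>\<^sub>w 0 \<xi> (m * N))]"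
proof (cases "m * N")
  case (Suc k)
  then have "N dvd Suc k"
    by (metis dvd_triv_right)
  with Suc show ?thesis
    by (auto simp: Let_def)
next
  case 0
  show ?thesis
    unfolding 0 by simp
qed

text \<open>When the controller uses its gain on the predicted state, each period contributes
  exactly the \<open>deviation_gain\<close> of the disturbance's departures from \<open>L\<close> to payoff plus value. If that is
  never positive, the value decreases from period to period by at least the payoff.\<close>
theorem periodic_controller:
  fixes A :: "real^'n^'n" and B :: "real^'m^'n" and C :: "real^'n^'p" and D :: "real^'m^'p"
  assumes step: "riccati_step A B C D b P L K P" and P: "selfadj P" "\<And>x. 0 \<le> qf P x"
    and orth: "transpose C ** D = 0" and b: "0 \<le> b" and N: "1 \<le> N"
    and gain: "\<And>e. deviation_gain A B D b P L K e N \<le> 0"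
  shows "sqnorm (per_output A B C D (\<lambda>k \<xi> r. K *v saddle_state A B L K \<xi> r) N w) \<le> ennreal b * sqnorm w"
proof -
  define \<mu> where "\<mu> = (\<lambda>(k::nat) \<xi> r. K *v saddle_state A B L K \<xi> r)"
  define I where "I = info A B \<mu> (\<lambda>k _. N dvd k) (\<lambda>k _. w k) 0 0"
  define x where "x t = last (I t)" for t
  define u where "u t = control \<mu> t (I t)" for t
  define z where "z = per_output A B C D \<mu> N w"
  define e where "e t = w t - L *v (A *v x t + B *v u t)" for t
  have x_Suc: "x (Suc t) = A *v x t + B *v u t + w t" for t
    by (simp add: x_def u_def I_def Let_def)
  have z: "z t = C *v x t + D *v u t" for t
    by (simp add: z_def per_output_def x_def u_def I_def Let_def)
  have u: "u (m * N + j) = K *v saddle_state A B L K (x (m * N)) j" if "j < N" for m j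
  proof -
    have "I (m * N) = [x (m * N)]"
      unfolding I_def x_def by (rule info_periodic_at[OF N])
    then have "I (m * N + j) = info A B \<mu> (\<lambda>k _. N dvd k) (\<lambda>k _. w k) (m * N) (x (m * N)) j"
      using info_append[of A B \<mu> "\<lambda>k _. N dvd k" "\<lambda>k _. w k" 0 0 "m * N" "x (m * N)" j]
      by (simp add: I_def)
    then show ?thesis
      using info_periodic_within[OF that, of A B \<mu> "\<lambda>k _. w k" m "x (m * N)"]
      by (simp add: u_def control_def \<mu>_def)
  qed
  have x: "x (m * N + j) = saddle_state A B L K (x (m * N)) j + deviation A L (\<lambda>j. e (m * N + j)) j"
    if "j \<le> N" for m j
    using that
  proof (induction j)
    case (Suc j)
    then show ?case
      using u[of j m] by (simp add: x_Suc e_def Let_def matrix_vector_right_distrib algebra_simps)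
  qed simp
  define pay where "pay t = (norm (z t))\<^sup>2 - b * (norm (w t))\<^sup>2" for t
  have pay: "pay t + qf P (x (Suc t)) = qf P (x t) + sform B D P L (u t - K *v x t) - zform b P (e t)" for t
    using riccati_completion_of_squares[OF step P(1) orth, of "x t" "u t" "w t"]
    by (simp add: pay_def z x_Suc e_def)
  have block: "(\<Sum>j<i. pay (m * N + j)) + qf P (x (m * N + i)) =
      qf P (x (m * N)) + deviation_gain A B D b P L K (\<lambda>j. e (m * N + j)) i" if "i \<le> N" for m i
    using that
  proof (induction i)
    case (Suc i)
    have "u (m * N + i) - K *v x (m * N + i) = - (K *v deviation A L (\<lambda>j. e (m * N + j)) i)"
      using Suc.prems by (simp add: u x matrix_vector_right_distrib)
    then show ?case
      using Suc pay[of "m * N + i"] by (simp add: deviation_gain_def sform_minus)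
  qed (simp add: deviation_gain_def)
  have "sum pay {..<m * N} + qf P (x (m * N)) \<le> 0" for m
  proof (induction m)
    case 0
    show ?case
      by (simp add: x_def I_def)
  next
    case (Suc m)
    have "sum pay {..<Suc m * N} = sum pay {..<m * N} + sum pay {m * N..<m * N + N}"
      by (simp add: lessThan_atLeast0 sum.atLeastLessThan_concat add.commute)
    also have "sum pay {m * N..<m * N + N} = (\<Sum>j<N. pay (m * N + j))"
      using sum.shift_bounds_nat_ivl[of pay 0 "m * N" N] by (simp add: lessThan_atLeast0 add.commute)
    finally show ?case
      using Suc block[of N m] gain[of "\<lambda>j. e (m * N + j)"] by (simp add: add.commute)
  qed
  then have "sum pay {..<m * N} \<le> 0" for m
    using P(2) by (smt (verit))
  then have bound: "(\<Sum>t<m * N. (norm (z t))\<^sup>2) \<le> b * energy w (m * N)" for m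
    by (simp add: pay_def energy_def sum_subtractf sum_distrib_left)
  have "sqnorm z \<le> ennreal b * sqnorm w"
    unfolding sqnorm_def[of z] suminf_eq_SUP
  proof (rule SUP_least)
    fix n
    have "(\<Sum>t<n. ennreal ((norm (z t))\<^sup>2)) \<le> (\<Sum>t<n * N. ennreal ((norm (z t))\<^sup>2))"
      using N by (intro sum_mono2) (auto intro: less_le_trans)
    also have "\<dots> = ennreal (\<Sum>t<n * N. (norm (z t))\<^sup>2)"
      by simp
    also have "\<dots> \<le> ennreal (b * energy w (n * N))"
      by (intro ennreal_leI bound)
    also have "\<dots> = ennreal b * (\<Sum>t<n * N. ennreal ((norm (w t))\<^sup>2))"
      using b by (simp add: ennreal_mult energy_nonneg energy_def sum_nonneg)
    also have "\<dots> \<le> ennreal b * sqnorm w"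
      unfolding sqnorm_def by (intro mult_left_mono sum_le_suminf) auto
    finally show "(\<Sum>t<n. ennreal ((norm (z t))\<^sup>2)) \<le> ennreal b * sqnorm w" .
  qed
  then show ?thesis
    by (simp add: z_def \<mu>_def)
qed

section \<open>Forcing transmissions\<close>

lemma inter_time_le_imp:
  assumes "inter_time \<sigma> s \<le> enat N"
  obtains \<tau> where "1 \<le> \<tau>" "\<tau> \<le> N" "\<sigma> (s + \<tau>)"
proof -
  define S where "S = {enat j | j. 1 \<le> j \<and> \<sigma> (s + j)}"
  have "Inf S \<le> enat N"
    using assms by (simp add: inter_time_def S_def)
  then have "S \<noteq> {}"
    by (auto simp: top_enat_def)
  then have "Inf S \<in> S"
    by (auto intro: wellorder_InfI)
  then show thesis
    using assms that by (auto simp: inter_time_def S_def)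
qed

text \<open>An attenuating loop with a solution of the Riccati equation, as provided by \<open>riccati_solution\<close>, and a deviation \<open>e\<close> that
  would pay off if nothing were transmitted for \<open>h\<close> steps.\<close>
locale saddle_loop = attenuating_loop A B C2 D21 \<mu>\<^sub>u \<mu>\<^sub>\<sigma> \<gamma> b
  for A :: "real^'n^'n" and B :: "real^'m^'n"
    and C2 :: "real^'n^'p" and D21 :: "real^'m^'p"
    and \<mu>\<^sub>u :: "('n, 'm) controller" and \<mu>\<^sub>\<sigma> :: "'n scheduler" and \<gamma> b :: real +
  fixes P L :: "real^'n^'n" and K :: "real^'n^'m" and e :: "nat \<Rightarrow> real^'n" and h hbar :: nat
  assumes step: "riccati_step A B C2 D21 b P L K P"
    and selfadj: "selfadj P"
    and nonneg: "\<And>x. 0 \<le> qf P x"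
    and le: "\<And>x. qf P x \<le> \<gamma>\<^sup>2 * (norm x)\<^sup>2"
    and budget: "\<And>w T. w 0 \<noteq> 0 \<Longrightarrow> 1 \<le> T \<Longrightarrow> sum (payoff w) {..<T} + qf P (state w T) \<le> 0"
    and gain_pos: "0 < deviation_gain A B D21 b P L K e (Suc h)"
    and transmits: "\<And>w s. w \<in> ell2 \<Longrightarrow> w 0 \<noteq> 0 \<Longrightarrow> 1 \<le> s \<Longrightarrow> sends w s \<Longrightarrow>
      inter_time (sends w) s \<le> enat hbar"
begin

text \<open>The state together with the energy spent so far. Everything a strategy below does in one step is
  bounded by a constant times this quantity, so it grows by at most a constant factor per step.\<close>
definition size :: "(nat \<Rightarrow> real^'n) \<Rightarrow> nat \<Rightarrow> real" where
  "size w t = norm (state w t) + sqrt (energy w t)"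

lemma size_cong: "(\<And>t. t < T \<Longrightarrow> w t = w' t) \<Longrightarrow> size w T = size w' T"
  using causal(1)[of T w w'] energy_cong[of T w w'] by (simp add: size_def)

lemma b_pos: "0 < b"
  using b_gt by (rule le_less_trans[rotated]) simp

lemma next_state_bound:
  obtains c where "0 \<le> c"
    "\<And>w t. w 0 \<noteq> 0 \<Longrightarrow> norm (A *v state w t + B *v inp w t) \<le> c * size w t"
proof -
  obtain a where a: "0 \<le> a" "\<And>x. norm (A *v x) \<le> a * norm x"
    using norm_matrix_vector_le[of A] by blast
  obtain a' where a': "0 \<le> a'" "\<And>u. norm (B *v u) \<le> a' * norm u"
    using norm_matrix_vector_le[of B] by blast
  obtain c where c: "0 < c" "\<And>w t. w 0 \<noteq> 0 \<Longrightarrow> norm (inp w t) \<le> c * sqrt (energy w t)"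
    using input_bound by blast
  have "norm (A *v state w t + B *v inp w t) \<le> (a + a' * c) * size w t" if "w 0 \<noteq> 0" for w t
  proof -
    have "norm (A *v state w t + B *v inp w t) \<le> a * norm (state w t) + a' * norm (inp w t)"
      by (intro order_trans[OF norm_triangle_ineq] add_mono a a')
    also have "\<dots> \<le> a * size w t + a' * (c * size w t)"
    proof (intro add_mono mult_left_mono a(1) a'(1))
      show "norm (state w t) \<le> size w t"
        by (simp add: size_def energy_nonneg)
      have "norm (inp w t) \<le> c * sqrt (energy w t)"
        using that by (rule c(2))
      also have "\<dots> \<le> c * size w t"
        using c(1) by (simp add: size_def)
      finally show "norm (inp w t) \<le> c * size w t" .
    qed
    finally show ?thesis
      by (simp add: algebra_simps)
  qed
  then show thesis
    using a(1) a'(1) c(1) by (intro that[of "a + a' * c"]) auto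
qed

lemma size_growth:
  assumes "0 \<le> c"
  obtains \<rho> where "1 \<le> \<rho>"
    "\<And>w s N. w 0 \<noteq> 0 \<Longrightarrow> (\<And>t. s \<le> t \<Longrightarrow> t < s + N \<Longrightarrow> norm (w t) \<le> c * size w t) \<Longrightarrow>
      size w (s + N) \<le> \<rho> ^ N * size w s"
proof -
  obtain a where a: "0 \<le> a"
    "\<And>w t. w 0 \<noteq> 0 \<Longrightarrow> norm (A *v state w t + B *v inp w t) \<le> a * size w t"
    using next_state_bound by blast
  define \<rho> where "\<rho> = 1 + a + 2 * c"
  have \<rho>: "1 \<le> \<rho>"
    using a(1) assms by (simp add: \<rho>_def)
  have one: "size w (Suc t) \<le> \<rho> * size w t" if "w 0 \<noteq> 0" "norm (w t) \<le> c * size w t" for w t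
  proof -
    have "norm (state w (Suc t)) \<le> norm (A *v state w t + B *v inp w t) + norm (w t)"
      by (simp add: cl_state_Suc norm_triangle_ineq)
    moreover have "sqrt (energy w (Suc t)) \<le> sqrt (energy w t) + norm (w t)"
      using sqrt_add_le_add_sqrt[of "energy w t" "(norm (w t))\<^sup>2"]
      by (simp add: energy_Suc energy_nonneg)
    ultimately have "size w (Suc t) \<le> a * size w t + 2 * (c * size w t) + sqrt (energy w t)"
      using that a(2)[of w t] by (simp add: size_def[of w "Suc t"])
    also have "\<dots> \<le> a * size w t + 2 * (c * size w t) + size w t"
      by (simp add: size_def)
    finally show ?thesis
      by (simp add: \<rho>_def algebra_simps)
  qed
  have "size w (s + N) \<le> \<rho> ^ N * size w s"
    if "w 0 \<noteq> 0" "\<And>t. s \<le> t \<Longrightarrow> t < s + N \<Longrightarrow> norm (w t) \<le> c * size w t" for w s N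
    using that(2)
  proof (induction N)
    case (Suc N)
    have "size w (s + Suc N) \<le> \<rho> * size w (s + N)"
      using one[of w "s + N"] that(1) Suc.prems by simp
    also have "\<dots> \<le> \<rho> * (\<rho> ^ N * size w s)"
      using \<rho> Suc by (intro mult_left_mono) auto
    finally show ?case
      by (simp add: mult.assoc)
  qed simp
  then show thesis
    using that \<rho> by blast
qed

lemma size_nonneg: "0 \<le> size w t"
  by (simp add: size_def energy_nonneg)

lemma transmits_finite:
  assumes "w 0 \<noteq> 0" "1 \<le> s" "sends w s" "\<And>t. T \<le> t \<Longrightarrow> w t = 0"
  obtains \<tau> where "1 \<le> \<tau>" "\<tau> \<le> hbar" "sends w (s + \<tau>)"
proof -
  have "w \<in> ell2"
    unfolding ell2_def using assms(4) by (auto intro!: summable_finite[of "{..<T}"]) (meson not_le)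
  then show thesis
    using inter_time_le_imp[OF transmits] assms that by blast
qed

text \<open>Cancelling the undisturbed next state, \<open>w = - (A x + B u)\<close>, keeps the state at \<open>0\<close> until a
  transmission occurs. The inputs that have to be cancelled are small by \<open>input_bound\<close>.\<close>
lemma reset:
  obtains \<rho> where "1 \<le> \<rho>"
    "\<And>w s. w 0 \<noteq> 0 \<Longrightarrow> 1 \<le> s \<Longrightarrow> sends w s \<Longrightarrow> \<exists>w' \<tau>. (\<forall>t<s. w' t = w t) \<and> 1 \<le> \<tau> \<and> \<tau> \<le> hbar \<and>
      inf_set w' (s + \<tau>) = [0] \<and> size w' (s + \<tau>) \<le> \<rho> * size w s"
proof -
  obtain c where c: "0 \<le> c"
    "\<And>w t. w 0 \<noteq> 0 \<Longrightarrow> norm (A *v state w t + B *v inp w t) \<le> c * size w t"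
    using next_state_bound by blast
  obtain \<rho> where \<rho>: "1 \<le> \<rho>"
    "\<And>w s N. w 0 \<noteq> 0 \<Longrightarrow> (\<And>t. s \<le> t \<Longrightarrow> t < s + N \<Longrightarrow> norm (w t) \<le> c * size w t) \<Longrightarrow>
      size w (s + N) \<le> \<rho> ^ N * size w s"
    using size_growth[OF c(1)] by blast
  have "\<exists>w' \<tau>. (\<forall>t<s. w' t = w t) \<and> 1 \<le> \<tau> \<and> \<tau> \<le> hbar \<and>
      inf_set w' (s + \<tau>) = [0] \<and> size w' (s + \<tau>) \<le> \<rho> ^ hbar * size w s"
    if w: "w 0 \<noteq> 0" "1 \<le> s" "sends w s" for w s
  proof -
    obtain w' where w': "\<And>t. t < s \<Longrightarrow> w' t = w t"
      "\<And>t. s \<le> t \<Longrightarrow> t < s + hbar \<Longrightarrow> w' t = - (A *v state w' t + B *v inp w' t)"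
      "\<And>t. s + hbar \<le> t \<Longrightarrow> w' t = 0"
      using realize_feedback[of s w hbar "\<lambda>t x u. - (A *v x + B *v u)"] by blast
    have "w' 0 \<noteq> 0" "sends w' s"
      using w w'(1) causal(3)[of s w' w] by auto
    then obtain \<tau> where \<tau>: "1 \<le> \<tau>" "\<tau> \<le> hbar" "sends w' (s + \<tau>)"
      using transmits_finite[of w' s "s + hbar"] w(2) w'(3) by blast
    then obtain j where j: "\<tau> = Suc j"
      by (cases \<tau>) auto
    have "state w' (s + \<tau>) = 0"
      using w'(2)[of "s + j"] \<tau>(2) by (simp add: j cl_state_Suc)
    then have "inf_set w' (s + \<tau>) = [0]"
      using \<tau> w(2) by (simp add: sends_iff)
    moreover have "size w' (s + \<tau>) \<le> \<rho> ^ \<tau> * size w' s"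
    proof (rule \<rho>(2))
      show "w' 0 \<noteq> 0"
        by fact
    next
      fix t
      assume "s \<le> t" "t < s + \<tau>"
      then have "norm (w' t) = norm (A *v state w' t + B *v inp w' t)"
        using w'(2)[of t] \<tau>(2) by (metis add_le_cancel_left less_le_trans norm_minus_cancel)
      then show "norm (w' t) \<le> c * size w' t"
        using c(2)[of w' t] \<open>w' 0 \<noteq> 0\<close> by simp
    qed
    moreover have "\<rho> ^ \<tau> * size w' s \<le> \<rho> ^ hbar * size w s"
      using \<rho>(1) \<tau>(2) size_cong[of s w' w] w'(1)
      by (auto intro!: mult_mono power_increasing size_nonneg)
    ultimately show ?thesis
      using w'(1) \<tau> by (intro exI[of _ w'] exI[of _ \<tau>]) auto
  qed
  then show thesis
    using \<rho>(1) by (intro that[of "\<rho> ^ hbar"]) auto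
qed

lemma input_without_transmission:
  assumes "1 \<le> s" "sends w s" "\<And>\<tau>. 1 \<le> \<tau> \<Longrightarrow> \<tau> \<le> j \<Longrightarrow> \<not> sends w (s + \<tau>)"
  shows "inp w (s + j) = \<mu>\<^sub>u (s + j) (state w s) j"
proof -
  have "last_tx (sends w) (s + j) = s"
    using assms(3)
  proof (induction j)
    case 0
    show ?case
      using last_tx_tx[of "sends w", OF assms(2)] by simp
  next
    case (Suc j)
    then show ?case
      using last_tx_Suc_no_tx[of "sends w" "s + j"] Suc.prems[of "Suc j"] by simp
  qed
  then show ?thesis
    using assms(1) by (simp add: cl_input_eq)
qed

lemma payoff_from:
  "sum (payoff w) {s..<s + N} + qf P (state w (s + N)) = qf P (state w s) +
    (\<Sum>j<N. sform B D21 P L (inp w (s + j) - K *v state w (s + j))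
      - zform b P (w (s + j) - L *v (A *v state w (s + j) + B *v inp w (s + j))))"
proof (induction N)
  case (Suc N)
  then show ?case
    using riccati_completion_of_squares[OF step selfadj orth, of "state w (s + N)" "inp w (s + N)" "w (s + N)"]
    by (simp add: payoff_def cl_output_def cl_state_Suc)
qed simp

text \<open>Suppose that both signs of the deviation avoid a transmission for \<open>h\<close> steps. The controller then
  uses the same inputs in both runs, while the states differ by \<open>2 \<kappa>\<close> times the deviation. By
  the parallelogram law the controller's losses in the two runs add up to at least
  \<open>2 \<kappa>\<^sup>2\<close> times its loss on the deviation alone, so that the two runs together earn at
  least \<open>2 \<kappa>\<^sup>2\<close> times the \<open>deviation_gain\<close>. By the budget they cannot earn more than the energy spent
  before, weighted by \<open>2 b\<close>.\<close>
lemma forced_transmission: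
  assumes "w 0 \<noteq> 0" "1 \<le> s" "sends w s"
    and \<kappa>: "b * energy w s < \<kappa>\<^sup>2 * deviation_gain A B D21 b P L K e (Suc h)"
    and agree: "\<And>\<delta> t. \<delta> \<in> {-1, 1} \<Longrightarrow> t < s \<Longrightarrow> v \<delta> t = w t"
    and v: "\<And>\<delta> t. \<delta> \<in> {-1, 1} \<Longrightarrow> s \<le> t \<Longrightarrow> t < s + Suc h \<Longrightarrow>
      v \<delta> t = L *v (A *v state (v \<delta>) t + B *v inp (v \<delta>) t) + (\<delta> * \<kappa>) *\<^sub>R e (t - s)"
  obtains \<delta> \<tau> where "\<delta> \<in> {-1, 1::real}" "1 \<le> \<tau>" "\<tau> \<le> h" "sends (v \<delta>) (s + \<tau>)"
proof (rule ccontr)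
  assume "\<not> thesis"
  with that have no: "\<not> sends (v \<delta>) (s + \<tau>)" if "\<delta> \<in> {-1, 1}" "1 \<le> \<tau>" "\<tau> \<le> h" for \<delta> \<tau>
    using that by blast
  have state_s: "state (v \<delta>) s = state w s" and sends_s: "sends (v \<delta>) s"
    and energy_s: "energy (v \<delta>) s = energy w s" and v0: "v \<delta> 0 \<noteq> 0" if "\<delta> \<in> {-1, 1}" for \<delta>
    using causal(1,3)[of s "v \<delta>" w] energy_cong[of s "v \<delta>" w] agree[OF that] assms(1-3) by auto
  have u: "inp (v \<delta>) (s + j) = \<mu>\<^sub>u (s + j) (state w s) j" if "\<delta> \<in> {-1, 1}" "j \<le> h" for \<delta> j
    using input_without_transmission[OF assms(2) sends_s[OF that(1)], of j] no[OF that(1)] that(2)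
      state_s[OF that(1)] by simp
  define d where "d j = deviation A L e j" for j
  define y where "y \<delta> j = A *v state (v \<delta>) (s + j) + B *v inp (v \<delta>) (s + j)" for \<delta> j
  have vy: "v \<delta> (s + j) = L *v y \<delta> j + (\<delta> * \<kappa>) *\<^sub>R e j" if "\<delta> \<in> {-1, 1}" "j \<le> h" for \<delta> j
    using v[OF that(1), of "s + j"] that(2) by (simp add: y_def)
  have diff: "state (v 1) (s + j) - state (v (-1)) (s + j) = (2 * \<kappa>) *\<^sub>R d j" if "j \<le> h" for j
    using that
  proof (induction j)
    case 0
    show ?case
      using state_s[of 1] state_s[of "-1"] by (simp add: d_def)
  next
    case (Suc j)
    have "y 1 j - y (-1) j = A *v (state (v 1) (s + j) - state (v (-1)) (s + j))"
      using u[of 1 j] u[of "-1" j] Suc.prems by (simp add: y_def matrix_vector_mult_diff_distrib)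
    also have "\<dots> = (2 * \<kappa>) *\<^sub>R (A *v d j)"
      using Suc by (simp add: matrix_vector_mult_scaleR)
    finally have yd: "y 1 j - y (-1) j = (2 * \<kappa>) *\<^sub>R (A *v d j)" .
    have "state (v 1) (s + Suc j) - state (v (-1)) (s + Suc j) =
        (y 1 j - y (-1) j) + L *v (y 1 j - y (-1) j) + (2 * \<kappa>) *\<^sub>R e j"
    proof -
      have "state (v \<delta>) (s + Suc j) = y \<delta> j + L *v y \<delta> j + (\<delta> * \<kappa>) *\<^sub>R e j" if "\<delta> \<in> {-1, 1}" for \<delta>
        using vy[OF that, of j] Suc.prems by (simp add: cl_state_Suc y_def)
      moreover have "(2 * \<kappa>) *\<^sub>R e j = \<kappa> *\<^sub>R e j + \<kappa> *\<^sub>R e j"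
        by (simp flip: scaleR_left_distrib)
      ultimately show ?thesis
        by (simp add: matrix_vector_mult_diff_distrib del: add_Suc_right)
    qed
    then show ?case
      by (simp add: yd d_def matrix_vector_mult_scaleR scaleR_right_distrib)
  qed
  define q where "q \<delta> j = inp (v \<delta>) (s + j) - K *v state (v \<delta>) (s + j)" for \<delta> j
  have half: "(\<Sum>j<Suc h. sform B D21 P L (q \<delta> j) - \<kappa>\<^sup>2 * zform b P (e j)) \<le> b * energy w s"
    if \<delta>: "\<delta> \<in> {-1, 1}" for \<delta>
  proof -
    have "(\<Sum>j<Suc h. sform B D21 P L (q \<delta> j) - \<kappa>\<^sup>2 * zform b P (e j)) =
        (\<Sum>j<Suc h. sform B D21 P L (q \<delta> j) - zform b P (v \<delta> (s + j) - L *v y \<delta> j))"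
    proof (rule sum.cong)
      fix j
      assume "j \<in> {..<Suc h}"
      then have "zform b P (v \<delta> (s + j) - L *v y \<delta> j) = (\<delta> * \<kappa>)\<^sup>2 * zform b P (e j)"
        using vy[OF \<delta>, of j] by (simp add: zform_scaleR)
      then show "sform B D21 P L (q \<delta> j) - \<kappa>\<^sup>2 * zform b P (e j) =
          sform B D21 P L (q \<delta> j) - zform b P (v \<delta> (s + j) - L *v y \<delta> j)"
        using \<delta> by auto
    qed simp
    also have "\<dots> \<le> sum (payoff (v \<delta>)) {s..<s + Suc h} + qf P (state (v \<delta>) (s + Suc h))"
      using payoff_from[of "v \<delta>" s "Suc h"] nonneg[of "state (v \<delta>) s"] by (simp only: q_def y_def)
    also have "\<dots> \<le> - sum (payoff (v \<delta>)) {..<s}"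
      using budget[of "v \<delta>" "s + Suc h"] v0[OF \<delta>]
        sum.atLeastLessThan_concat[of 0 s "s + Suc h" "payoff (v \<delta>)"]
      by (simp add: lessThan_atLeast0)
    also have "\<dots> = b * energy (v \<delta>) s - (\<Sum>t<s. (norm (outp (v \<delta>) t))\<^sup>2)"
      by (simp add: payoff_def energy_def sum_subtractf sum_distrib_left)
    also have "\<dots> \<le> b * energy w s"
      by (simp add: energy_s[OF \<delta>] sum_nonneg)
    finally show ?thesis .
  qed
  have "2 * \<kappa>\<^sup>2 * (sform B D21 P L (K *v d j) - zform b P (e j)) \<le>
      (sform B D21 P L (q 1 j) - \<kappa>\<^sup>2 * zform b P (e j)) + (sform B D21 P L (q (-1) j) - \<kappa>\<^sup>2 * zform b P (e j))"
    if "j \<le> h" for j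
  proof -
    have "q 1 j - q (-1) j = - (K *v (state (v 1) (s + j) - state (v (-1)) (s + j)))"
      using u[of 1 j] u[of "-1" j] that by (simp add: q_def matrix_vector_mult_diff_distrib)
    also have "\<dots> = (- 2 * \<kappa>) *\<^sub>R (K *v d j)"
      by (simp add: diff[OF that] matrix_vector_mult_scaleR)
    finally have "sform B D21 P L (q 1 j - q (-1) j) = 4 * \<kappa>\<^sup>2 * sform B D21 P L (K *v d j)"
      by (simp only: sform_scaleR) (simp add: power_mult_distrib)
    moreover have "0 \<le> sform B D21 P L (q 1 j + q (-1) j)"
      by (rule sform_nonneg[OF step selfadj nonneg le])
    ultimately show ?thesis
      using sform_parallelogram[of B D21 P L "q 1 j" "q (-1) j"] by (simp add: algebra_simps)
  qed
  then have "(\<Sum>j<Suc h. 2 * \<kappa>\<^sup>2 * (sform B D21 P L (K *v d j) - zform b P (e j))) \<le>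
      (\<Sum>j<Suc h. (sform B D21 P L (q 1 j) - \<kappa>\<^sup>2 * zform b P (e j)) + (sform B D21 P L (q (-1) j) - \<kappa>\<^sup>2 * zform b P (e j)))"
    by (intro sum_mono) simp
  then have "2 * \<kappa>\<^sup>2 * deviation_gain A B D21 b P L K e (Suc h) \<le> 2 * (b * energy w s)"
    using half[of 1, OF insertI2[OF singletonI]] half[of "-1", OF insertI1]
    by (simp only: deviation_gain_def d_def[symmetric] sum_distrib_left[symmetric] sum.distrib)
  with \<kappa> show False
    by simp
qed

text \<open>The scale \<open>\<kappa>\<close> is chosen proportional to the square root of the energy already spent, just large enough to force a
  transmission. The price of doing so is therefore proportional to the current size.\<close>
lemma early_transmission:
  obtains \<rho> where "1 \<le> \<rho>"
    "\<And>w s. w 0 \<noteq> 0 \<Longrightarrow> 1 \<le> s \<Longrightarrow> sends w s \<Longrightarrow> \<exists>w' \<tau>. (\<forall>t<s. w' t = w t) \<and> 1 \<le> \<tau> \<and> \<tau> \<le> h \<and>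
      sends w' (s + \<tau>) \<and> size w' (s + \<tau>) \<le> \<rho> * size w s"
proof -
  obtain a where a: "0 \<le> a"
    "\<And>w t. w 0 \<noteq> 0 \<Longrightarrow> norm (A *v state w t + B *v inp w t) \<le> a * size w t"
    using next_state_bound by blast
  obtain l where l: "0 \<le> l" "\<And>x. norm (L *v x) \<le> l * norm x"
    using norm_matrix_vector_le[of L] by blast
  define G where "G = deviation_gain A B D21 b P L K e (Suc h)"
  \<comment> \<open>The constant \<open>b + 1\<close> exceeds the factor \<open>b\<close> with which past energy enters the budget.\<close>
  define g where "g = sqrt ((b + 1) / G)"
  define m where "m = (\<Sum>j<Suc h. norm (e j))"
  have g: "0 \<le> g" "g\<^sup>2 * G = b + 1"
    using gain_pos b_pos by (simp_all add: g_def G_def)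
  have m: "0 \<le> m" "\<And>j. j \<le> h \<Longrightarrow> norm (e j) \<le> m"
    unfolding m_def by (auto intro: sum_nonneg member_le_sum[of _ "{..<Suc h}" "\<lambda>j. norm (e j)"] simp del: sum.lessThan_Suc)
  define c where "c = l * a + g * m"
  have c: "0 \<le> c"
    using l(1) a(1) g(1) m(1) by (simp add: c_def)
  obtain \<rho> where \<rho>: "1 \<le> \<rho>"
    "\<And>w s N. w 0 \<noteq> 0 \<Longrightarrow> (\<And>t. s \<le> t \<Longrightarrow> t < s + N \<Longrightarrow> norm (w t) \<le> c * size w t) \<Longrightarrow>
      size w (s + N) \<le> \<rho> ^ N * size w s"
    using size_growth[OF c] by blast
  have "\<exists>w' \<tau>. (\<forall>t<s. w' t = w t) \<and> 1 \<le> \<tau> \<and> \<tau> \<le> h \<and>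
      sends w' (s + \<tau>) \<and> size w' (s + \<tau>) \<le> \<rho> ^ h * size w s"
    if w: "w 0 \<noteq> 0" "1 \<le> s" "sends w s" for w s
  proof -
    define \<kappa> where "\<kappa> = g * sqrt (energy w s)"
    have "\<exists>w'. (\<forall>t<s. w' t = w t) \<and> (\<forall>t. s \<le> t \<and> t < s + Suc h \<longrightarrow>
        w' t = L *v (A *v state w' t + B *v inp w' t) + (\<delta> * \<kappa>) *\<^sub>R e (t - s))" for \<delta>
      using realize_feedback[of s w "Suc h" "\<lambda>t x u. L *v (A *v x + B *v u) + (\<delta> * \<kappa>) *\<^sub>R e (t - s)"]
      by metis
    then obtain v where v: "\<And>\<delta> t. t < s \<Longrightarrow> v \<delta> t = w t"
      "\<And>\<delta> t. s \<le> t \<Longrightarrow> t < s + Suc h \<Longrightarrow>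
        v \<delta> t = L *v (A *v state (v \<delta>) t + B *v inp (v \<delta>) t) + (\<delta> * \<kappa>) *\<^sub>R e (t - s)"
      by metis
    have "\<kappa>\<^sup>2 * G = (b + 1) * energy w s"
      using g(2) by (simp add: \<kappa>_def power_mult_distrib energy_nonneg mult.commute mult.left_commute)
    then have "b * energy w s < \<kappa>\<^sup>2 * G"
      using energy_pos[of w s] w by (simp add: algebra_simps)
    then obtain \<delta> \<tau> where \<delta>: "\<delta> \<in> {-1, 1::real}" "1 \<le> \<tau>" "\<tau> \<le> h" "sends (v \<delta>) (s + \<tau>)"
      using forced_transmission[OF w, of \<kappa> v] v unfolding G_def by blast
    have v0: "v \<delta> 0 \<noteq> 0"
      using v(1)[of 0] w by simp
    have "size (v \<delta>) (s + \<tau>) \<le> \<rho> ^ \<tau> * size (v \<delta>) s"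
    proof (rule \<rho>(2))
      show "v \<delta> 0 \<noteq> 0"
        by (rule v0)
    next
      fix t
      assume t: "s \<le> t" "t < s + \<tau>"
      have "norm (v \<delta> t) \<le> norm (L *v (A *v state (v \<delta>) t + B *v inp (v \<delta>) t)) + norm ((\<delta> * \<kappa>) *\<^sub>R e (t - s))"
        using v(2)[of t \<delta>] t \<delta>(3) norm_triangle_ineq by (metis add_le_cancel_left le_SucI less_le_trans)
      also have "\<dots> \<le> l * (a * size (v \<delta>) t) + \<kappa> * m"
      proof (rule add_mono)
        show "norm (L *v (A *v state (v \<delta>) t + B *v inp (v \<delta>) t)) \<le> l * (a * size (v \<delta>) t)"
          by (rule order_trans[OF l(2)]) (intro mult_left_mono a(2) v0 l(1))
        have "norm ((\<delta> * \<kappa>) *\<^sub>R e (t - s)) = \<kappa> * norm (e (t - s))"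
          using \<delta>(1) g(1) by (auto simp: \<kappa>_def energy_nonneg)
        also have "\<dots> \<le> \<kappa> * m"
          using t \<delta>(3) g(1) by (intro mult_left_mono m(2)) (auto simp: \<kappa>_def energy_nonneg)
        finally show "norm ((\<delta> * \<kappa>) *\<^sub>R e (t - s)) \<le> \<kappa> * m" .
      qed
      also have "\<kappa> \<le> g * size (v \<delta>) t"
      proof -
        have "energy w s = energy (v \<delta>) s"
          using v(1) by (intro energy_cong) simp
        also have "\<dots> \<le> energy (v \<delta>) t"
          using t(1) by (rule energy_mono)
        finally have "sqrt (energy w s) \<le> size (v \<delta>) t"
          by (simp add: size_def add_increasing)
        then show ?thesis
          unfolding \<kappa>_def using g(1) by (rule mult_left_mono)
      qed
      finally show "norm (v \<delta> t) \<le> c * size (v \<delta>) t"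
        using m(1) by (simp add: c_def algebra_simps mult_right_mono)
    qed
    also have "\<rho> ^ \<tau> * size (v \<delta>) s \<le> \<rho> ^ h * size w s"
      using \<rho>(1) \<delta>(3) size_cong[of s "v \<delta>" w] v(1)
      by (auto intro!: mult_mono power_increasing size_nonneg)
    finally show ?thesis
      using v(1) \<delta> by (intro exI[of _ "v \<delta>"] exI[of _ \<tau>]) auto
  qed
  then show thesis
    using \<rho>(1) by (intro that[of "\<rho> ^ h"]) auto
qed

end

section \<open>Blocks of transmissions with little energy\<close>

text \<open>A choice from a finite set that is possible for every tolerance \<open>\<eta>\<close> can be made independently of
  \<open>\<eta>\<close>: otherwise each element fails at some tolerance, and all of them fail at the least of these.\<close>
lemma uniform_choice:
  fixes Q :: "real \<Rightarrow> 'a \<Rightarrow> bool"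
  assumes "finite F" and ex: "\<And>\<eta>. 0 < \<eta> \<Longrightarrow> \<exists>s\<in>F. Q \<eta> s"
    and mono: "\<And>\<eta> \<eta>' s. \<eta> \<le> \<eta>' \<Longrightarrow> Q \<eta> s \<Longrightarrow> Q \<eta>' s"
  shows "\<exists>s\<in>F. \<forall>\<eta>>0. Q \<eta> s"
proof (rule ccontr)
  assume "\<not> ?thesis"
  then have "\<forall>s\<in>F. \<exists>\<eta>>0. \<not> Q \<eta> s"
    by blast
  then obtain \<eta> where \<eta>: "\<And>s. s \<in> F \<Longrightarrow> 0 < \<eta> s" "\<And>s. s \<in> F \<Longrightarrow> \<not> Q (\<eta> s) s"
    by metis
  define m where "m = Min (insert 1 (\<eta> ` F))"
  have "0 < m"
    using \<eta>(1) assms(1) by (simp add: m_def)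
  then obtain s where "s \<in> F" "Q m s"
    using ex by blast
  moreover have "m \<le> \<eta> s"
    using \<open>s \<in> F\<close> assms(1) by (simp add: m_def)
  ultimately show False
    using mono \<eta>(2) by blast
qed

context saddle_loop
begin

definition transmissions :: "(nat \<Rightarrow> real^'n) \<Rightarrow> nat \<Rightarrow> nat \<Rightarrow> nat" where
  "transmissions w s s' = card {t \<in> {s<..s'}. sends w t}"

lemma transmissions_cong:
  assumes "\<And>t. t < s' \<Longrightarrow> w t = w' t"
  shows "transmissions w s s' = transmissions w' s s'"
proof -
  have "{t \<in> {s<..s'}. sends w t} = {t \<in> {s<..s'}. sends w' t}"
    using causal(3)[of _ w w'] assms by (metis (no_types, lifting) Collect_cong greaterThanAtMost_iff less_le_trans)
  then show ?thesis
    by (simp add: transmissions_def)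
qed

lemma transmissions_mono: "s' \<le> s'' \<Longrightarrow> transmissions w s s' \<le> transmissions w s s''"
  unfolding transmissions_def by (rule card_mono) auto

lemma transmissions_Suc:
  assumes "s \<le> s'" "s' < s''" "sends w s''"
  shows "Suc (transmissions w s s') \<le> transmissions w s s''"
proof -
  have "Suc (transmissions w s s') = card (insert s'' {t \<in> {s<..s'}. sends w t})"
    using assms by (simp add: transmissions_def)
  also have "\<dots> \<le> transmissions w s s''"
    unfolding transmissions_def using assms by (intro card_mono) auto
  finally show ?thesis .
qed

lemma transmissions_add:
  assumes "s \<le> s'" "s' \<le> s''"
  shows "transmissions w s s'' = transmissions w s s' + transmissions w s' s''"
proof -
  have "{t \<in> {s<..s''}. sends w t} = {t \<in> {s<..s'}. sends w t} \<union> {t \<in> {s'<..s''}. sends w t}"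
    using assms by auto
  then show ?thesis
    unfolding transmissions_def by (simp add: card_Un_disjoint disjoint_iff)
qed

text \<open>Each forced transmission multiplies the size by a constant, so \<open>n\<close> of them multiply it by a
  constant that depends on \<open>n\<close> only.\<close>
lemma many_transmissions:
  "\<exists>\<rho>\<ge>1. \<forall>w s. w 0 \<noteq> 0 \<longrightarrow> 1 \<le> s \<longrightarrow> sends w s \<longrightarrow> (\<exists>w' s'. (\<forall>t<s. w' t = w t) \<and> s \<le> s' \<and>
     s' \<le> s + n * h \<and> sends w' s' \<and> n \<le> transmissions w' s s' \<and> size w' s' \<le> \<rho> * size w s)"
proof (induction n)
  case 0
  show ?case
    by (rule exI[of _ 1]) auto
next
  case (Suc n)
  then obtain \<rho> where \<rho>: "1 \<le> \<rho>" "\<And>w s. w 0 \<noteq> 0 \<Longrightarrow> 1 \<le> s \<Longrightarrow> sends w s \<Longrightarrow> \<exists>w' s'. (\<forall>t<s. w' t = w t) \<and>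
      s \<le> s' \<and> s' \<le> s + n * h \<and> sends w' s' \<and> n \<le> transmissions w' s s' \<and> size w' s' \<le> \<rho> * size w s"
    by blast
  obtain \<rho>' where \<rho>': "1 \<le> \<rho>'"
    "\<And>w s. w 0 \<noteq> 0 \<Longrightarrow> 1 \<le> s \<Longrightarrow> sends w s \<Longrightarrow> \<exists>w' \<tau>. (\<forall>t<s. w' t = w t) \<and> 1 \<le> \<tau> \<and> \<tau> \<le> h \<and>
      sends w' (s + \<tau>) \<and> size w' (s + \<tau>) \<le> \<rho>' * size w s"
    using early_transmission by blast
  have "\<exists>w' s'. (\<forall>t<s. w' t = w t) \<and> s \<le> s' \<and> s' \<le> s + Suc n * h \<and> sends w' s' \<and>
      Suc n \<le> transmissions w' s s' \<and> size w' s' \<le> (\<rho>' * \<rho>) * size w s"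
    if w: "w 0 \<noteq> 0" "1 \<le> s" "sends w s" for w s
  proof -
    obtain w' s' where w': "\<forall>t<s. w' t = w t" "s \<le> s'" "s' \<le> s + n * h" "sends w' s'"
      "n \<le> transmissions w' s s'" "size w' s' \<le> \<rho> * size w s"
      using \<rho>(2)[of w s] w by blast
    have "w' 0 \<noteq> 0" "1 \<le> s'"
      using w w' by auto
    then obtain w'' \<tau> where w'': "\<forall>t<s'. w'' t = w' t" "1 \<le> \<tau>" "\<tau> \<le> h" "sends w'' (s' + \<tau>)"
      "size w'' (s' + \<tau>) \<le> \<rho>' * size w' s'"
      using \<rho>'(2)[of w' s'] w'(4) by blast
    have "transmissions w'' s s' = transmissions w' s s'"
      using w''(1) by (intro transmissions_cong) auto
    then have "Suc n \<le> transmissions w'' s (s' + \<tau>)"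
      using transmissions_Suc[of s s' "s' + \<tau>" w''] w'(2,5) w''(2,4) by simp
    moreover have "size w'' (s' + \<tau>) \<le> \<rho>' * (\<rho> * size w s)"
      using \<rho>'(1) w'(6) by (intro order_trans[OF w''(5)] mult_left_mono) auto
    ultimately show ?thesis
      using w' w'' by (intro exI[of _ w''] exI[of _ "s' + \<tau>"]) auto
  qed
  moreover have "1 \<le> \<rho>' * \<rho>"
    using \<rho>(1) \<rho>'(1) mult_mono[of 1 \<rho>' 1 \<rho>] by simp
  ultimately show ?case
    by blast
qed

lemma transmissions_then_reset:
  obtains \<rho> where "1 \<le> \<rho>"
    "\<And>w s. w 0 \<noteq> 0 \<Longrightarrow> 1 \<le> s \<Longrightarrow> sends w s \<Longrightarrow> \<exists>w' s'. (\<forall>t<s. w' t = w t) \<and> s < s' \<and>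
      s' \<le> s + n * h + hbar \<and> inf_set w' s' = [0] \<and> n \<le> transmissions w' s s' \<and> size w' s' \<le> \<rho> * size w s"
proof -
  obtain \<rho> where \<rho>: "1 \<le> \<rho>" "\<And>w s. w 0 \<noteq> 0 \<Longrightarrow> 1 \<le> s \<Longrightarrow> sends w s \<Longrightarrow> \<exists>w' s'. (\<forall>t<s. w' t = w t) \<and>
      s \<le> s' \<and> s' \<le> s + n * h \<and> sends w' s' \<and> n \<le> transmissions w' s s' \<and> size w' s' \<le> \<rho> * size w s"
    using many_transmissions[of n] by blast
  obtain \<rho>' where \<rho>': "1 \<le> \<rho>'"
    "\<And>w s. w 0 \<noteq> 0 \<Longrightarrow> 1 \<le> s \<Longrightarrow> sends w s \<Longrightarrow> \<exists>w' \<tau>. (\<forall>t<s. w' t = w t) \<and> 1 \<le> \<tau> \<and> \<tau> \<le> hbar \<and>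
      inf_set w' (s + \<tau>) = [0] \<and> size w' (s + \<tau>) \<le> \<rho>' * size w s"
    using reset by blast
  have "\<exists>w' s'. (\<forall>t<s. w' t = w t) \<and> s < s' \<and> s' \<le> s + n * h + hbar \<and> inf_set w' s' = [0] \<and>
      n \<le> transmissions w' s s' \<and> size w' s' \<le> (\<rho>' * \<rho>) * size w s"
    if w: "w 0 \<noteq> 0" "1 \<le> s" "sends w s" for w s
  proof -
    obtain w' s' where w': "\<forall>t<s. w' t = w t" "s \<le> s'" "s' \<le> s + n * h" "sends w' s'"
      "n \<le> transmissions w' s s'" "size w' s' \<le> \<rho> * size w s"
      using \<rho>(2)[of w s] w by blast
    have "w' 0 \<noteq> 0" "1 \<le> s'"
      using w w' by auto
    then obtain w'' \<tau> where w'': "\<forall>t<s'. w'' t = w' t" "1 \<le> \<tau>" "\<tau> \<le> hbar" "inf_set w'' (s' + \<tau>) = [0]"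
      "size w'' (s' + \<tau>) \<le> \<rho>' * size w' s'"
      using \<rho>'(2)[of w' s'] w'(4) by blast
    have "transmissions w'' s s' = transmissions w' s s'"
      using w''(1) by (intro transmissions_cong) auto
    then have "n \<le> transmissions w'' s (s' + \<tau>)"
      using transmissions_mono[of s' "s' + \<tau>" w'' s] w'(5) by simp
    moreover have "size w'' (s' + \<tau>) \<le> \<rho>' * (\<rho> * size w s)"
      using \<rho>'(1) w'(6) by (intro order_trans[OF w''(5)] mult_left_mono) auto
    ultimately show ?thesis
      using w' w'' by (intro exI[of _ w''] exI[of _ "s' + \<tau>"]) auto
  qed
  moreover have "1 \<le> \<rho>' * \<rho>"
    using \<rho>(1) \<rho>'(1) mult_mono[of 1 \<rho>' 1 \<rho>] by simp
  ultimately show thesis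
    using that by blast
qed

text \<open>At a cheap time the budget may ignore the past: what happens afterwards from the state \<open>0\<close> does not
  depend on how it was reached, so the energy spent before can be taken as small as desired.\<close>
definition cheap :: "nat \<Rightarrow> bool" where
  "cheap s \<longleftrightarrow> 1 \<le> s \<and> (\<forall>\<eta>>0. \<exists>w. w 0 \<noteq> 0 \<and> inf_set w s = [0] \<and> energy w s \<le> \<eta>)"

lemma energy_le_if_size_le: "size w s \<le> \<rho> * r \<Longrightarrow> energy w s \<le> (\<rho> * r)\<^sup>2"
  by (rule sqrt_le_D) (simp add: size_def, smt (verit) norm_ge_zero)

lemma size_at_rest: "1 \<le> s \<Longrightarrow> inf_set w s = [0] \<Longrightarrow> size w s = sqrt (energy w s)"
  by (simp add: size_def cl_state_def)

text \<open>Start with an arbitrarily small first value and reset at once.\<close>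
lemma cheap_exists: "\<exists>s. cheap s"
proof -
  obtain \<rho> where \<rho>: "1 \<le> \<rho>"
    "\<And>w s. w 0 \<noteq> 0 \<Longrightarrow> 1 \<le> s \<Longrightarrow> sends w s \<Longrightarrow> \<exists>w' \<tau>. (\<forall>t<s. w' t = w t) \<and> 1 \<le> \<tau> \<and> \<tau> \<le> hbar \<and>
      inf_set w' (s + \<tau>) = [0] \<and> size w' (s + \<tau>) \<le> \<rho> * size w s"
    using reset by blast
  have "\<exists>s\<in>{1..1 + hbar}. \<forall>\<eta>>0. \<exists>w. w 0 \<noteq> 0 \<and> inf_set w s = [0] \<and> energy w s \<le> \<eta>"
  proof (rule uniform_choice)
    fix \<eta> :: real
    assume \<eta>: "0 < \<eta>"
    \<comment> \<open>The size at time 1 is twice the norm of the first value: it counts as state and as energy.\<close>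
    define r where "r = sqrt \<eta> / (2 * \<rho>)"
    obtain x :: "real^'n" where x: "norm x = r"
      using vector_choose_size[of r] \<eta> \<rho>(1) by (auto simp: r_def)
    have r: "0 < r"
      using \<eta> \<rho>(1) by (simp add: r_def)
    define w where "w = (\<lambda>t::nat. x)"
    have "size w 1 = 2 * r"
      using x r state_1[of w] by (simp add: size_def energy_def w_def)
    moreover have "w 0 \<noteq> 0" "sends w 1"
      using x r cl_sigma_1 by (auto simp: w_def)
    ultimately obtain w' \<tau> where w': "\<forall>t<1. w' t = w t" "1 \<le> \<tau>" "\<tau> \<le> hbar"
      "inf_set w' (1 + \<tau>) = [0]" "size w' (1 + \<tau>) \<le> \<rho> * (2 * r)"
      using \<rho>(2)[of w 1] by auto
    have "energy w' (1 + \<tau>) \<le> (\<rho> * (2 * r))\<^sup>2"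
      by (rule energy_le_if_size_le[OF w'(5)])
    also have "\<dots> = \<eta>"
      using \<eta> \<rho>(1) by (simp add: r_def)
    finally show "\<exists>s\<in>{1..1 + hbar}. \<exists>w. w 0 \<noteq> 0 \<and> inf_set w s = [0] \<and> energy w s \<le> \<eta>"
      using w' \<open>w 0 \<noteq> 0\<close> by (intro bexI[of _ "1 + \<tau>"] exI[of _ w']) auto
  qed (auto intro: order_trans)
  then show ?thesis
    by (auto simp: cheap_def)
qed

text \<open>The end time of a block may depend on the energy allowed, but it lies in a finite window, so
  \<open>uniform_choice\<close> yields one end time for all energies. Reaching it by such blocks
  shows that it is cheap as well.\<close>
lemma cheap_block:
  assumes "cheap s"
  shows "\<exists>s'. s < s' \<and> s' \<le> s + n * h + hbar \<and> (\<forall>\<eta>>0. \<exists>w. w 0 \<noteq> 0 \<and> inf_set w s = [0] \<and>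
    inf_set w s' = [0] \<and> energy w s' \<le> \<eta> \<and> n \<le> transmissions w s s')"
proof -
  obtain \<rho> where \<rho>: "1 \<le> \<rho>"
    "\<And>w s. w 0 \<noteq> 0 \<Longrightarrow> 1 \<le> s \<Longrightarrow> sends w s \<Longrightarrow> \<exists>w' s'. (\<forall>t<s. w' t = w t) \<and> s < s' \<and>
      s' \<le> s + n * h + hbar \<and> inf_set w' s' = [0] \<and> n \<le> transmissions w' s s' \<and> size w' s' \<le> \<rho> * size w s"
    using transmissions_then_reset[of n] by blast
  have s: "1 \<le> s"
    using assms by (simp add: cheap_def)
  have "\<exists>s'\<in>{s<..s + n * h + hbar}. \<forall>\<eta>>0. \<exists>w. w 0 \<noteq> 0 \<and> inf_set w s = [0] \<and>
    inf_set w s' = [0] \<and> energy w s' \<le> \<eta> \<and> n \<le> transmissions w s s'"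
  proof (rule uniform_choice)
    fix \<eta> :: real
    assume \<eta>: "0 < \<eta>"
    then have "0 < \<eta> / \<rho>\<^sup>2"
      using \<rho>(1) by simp
    then obtain w where w: "w 0 \<noteq> 0" "inf_set w s = [0]" "energy w s \<le> \<eta> / \<rho>\<^sup>2"
      using assms unfolding cheap_def by blast
    have "sends w s"
      using w(2) s by (simp add: cl_sigma_def)
    then obtain w' s' where w': "\<forall>t<s. w' t = w t" "s < s'" "s' \<le> s + n * h + hbar"
      "inf_set w' s' = [0]" "n \<le> transmissions w' s s'" "size w' s' \<le> \<rho> * size w s"
      using \<rho>(2)[of w s] w(1) s by blast
    have "energy w' s' \<le> (\<rho> * size w s)\<^sup>2"
      by (rule energy_le_if_size_le[OF w'(6)])
    also have "\<dots> = \<rho>\<^sup>2 * energy w s"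
      by (simp add: size_at_rest[OF s w(2)] power_mult_distrib energy_nonneg)
    also have "\<dots> \<le> \<eta>"
      using w(3) \<rho>(1) by (simp add: field_simps)
    finally have "energy w' s' \<le> \<eta>" .
    moreover have "inf_set w' s = [0]"
      using inf_set_cong[OF s, of w' w] w'(1) w(2) by simp
    moreover have "w' 0 \<noteq> 0"
      using w(1) w'(1) s by auto
    ultimately show "\<exists>s'\<in>{s<..s + n * h + hbar}. \<exists>w. w 0 \<noteq> 0 \<and> inf_set w s = [0] \<and>
        inf_set w s' = [0] \<and> energy w s' \<le> \<eta> \<and> n \<le> transmissions w s s'"
      using w' by (intro bexI[of _ s'] exI[of _ w']) auto
  qed (auto intro: order_trans)
  then show ?thesis
    by (metis greaterThanAtMost_iff)
qed

lemma cheap_chain: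
  obtains S where "\<And>k. 1 \<le> S k" "\<And>k. S k < S (Suc k)" "\<And>k. S (Suc k) \<le> S k + k * h + hbar" "cheap (S 0)"
    "\<And>k \<eta>. 0 < \<eta> \<Longrightarrow> \<exists>w. w 0 \<noteq> 0 \<and> inf_set w (S k) = [0] \<and>
       inf_set w (S (Suc k)) = [0] \<and> energy w (S (Suc k)) \<le> \<eta> \<and> k \<le> transmissions w (S k) (S (Suc k))"
proof -
  define Q where "Q = (\<lambda>k s s'. s < s' \<and> s' \<le> s + k * h + hbar \<and> (\<forall>\<eta>>0. \<exists>w. w 0 \<noteq> 0 \<and> inf_set w s = [0] \<and>
       inf_set w s' = [0] \<and> energy w s' \<le> \<eta> \<and> k \<le> transmissions w s s'))"
  have "\<exists>S. \<forall>k. cheap (S k) \<and> Q k (S k) (S (Suc k))"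
  proof (rule dependent_nat_choice)
    show "\<exists>s. cheap s"
      by (rule cheap_exists)
  next
    fix s k
    assume "cheap s"
    then obtain s' where s': "Q k s s'"
      using cheap_block[of s k] by (auto simp: Q_def)
    then have "cheap s'"
      unfolding Q_def cheap_def by (metis One_nat_def Suc_leI bot_nat_0.extremum_strict neq0_conv)
    with s' show "\<exists>s'. cheap s' \<and> Q k s s'"
      by blast
  qed
  then obtain S where S: "\<And>k. cheap (S k)" "\<And>k. Q k (S k) (S (Suc k))"
    by blast
  show thesis
  proof (rule that[of S])
    show "1 \<le> S k" for k
      using S(1)[of k] by (simp add: cheap_def)
    show "S k < S (Suc k)" "S (Suc k) \<le> S k + k * h + hbar" for k
      using S(2)[of k] by (simp_all add: Q_def)
    show "cheap (S 0)"
      by (rule S(1))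
    show "\<exists>w. w 0 \<noteq> 0 \<and> inf_set w (S k) = [0] \<and> inf_set w (S (Suc k)) = [0] \<and>
        energy w (S (Suc k)) \<le> \<eta> \<and> k \<le> transmissions w (S k) (S (Suc k))" if "0 < \<eta>" for k \<eta>
      using S(2)[of k] that by (simp add: Q_def)
  qed
qed

text \<open>Consecutive blocks along a chain of cheap times fit together, because each starts and ends with
  the transmission of the state \<open>0\<close>; the signal of a block can be used no matter which past it was
  constructed with.\<close>
theorem frequent_transmissions:
  obtains w S where "w \<in> ell2" "w 0 \<noteq> 0" "strict_mono S"
    "\<And>k. S (Suc k) \<le> S k + k * h + hbar" "\<And>k. (\<Sum>j<k. j) \<le> card {t. t \<le> S k \<and> sends w t}"
proof -
  obtain S where S: "\<And>k. 1 \<le> S k" "\<And>k. S k < S (Suc k)" "\<And>k. S (Suc k) \<le> S k + k * h + hbar" "cheap (S 0)"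
    "\<And>k \<eta>. 0 < \<eta> \<Longrightarrow> \<exists>w. w 0 \<noteq> 0 \<and> inf_set w (S k) = [0] \<and>
       inf_set w (S (Suc k)) = [0] \<and> energy w (S (Suc k)) \<le> \<eta> \<and> k \<le> transmissions w (S k) (S (Suc k))"
    using cheap_chain by blast
  have S_mono: "strict_mono S"
    using S(2) by (simp add: strict_mono_Suc_iff)
  obtain w0 where w0: "w0 0 \<noteq> 0" "inf_set w0 (S 0) = [0]"
    using S(4) unfolding cheap_def by (metis zero_less_one)
  have "\<exists>w. inf_set w (S k) = [0] \<and> inf_set w (S (Suc k)) = [0] \<and>
      energy w (S (Suc k)) \<le> (1/2)^k \<and> k \<le> transmissions w (S k) (S (Suc k))" for k
    using S(5)[of "(1/2)^k" k] by auto
  then obtain W where W: "\<And>k. inf_set (W k) (S k) = [0]" "\<And>k. inf_set (W k) (S (Suc k)) = [0]"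
    "\<And>k. energy (W k) (S (Suc k)) \<le> (1/2)^k" "\<And>k. k \<le> transmissions (W k) (S k) (S (Suc k))"
    by metis
  \<comment> \<open>\<open>V k\<close> is the disturbance glued from the first \<open>k\<close> blocks; it is final before time \<open>S k\<close>.\<close>
  define V where "V = rec_nat w0 (\<lambda>k v t. if t < S k then v t else W k t)"
  have V_0: "V 0 = w0" and V_Suc: "V (Suc k) = (\<lambda>t. if t < S k then V k t else W k t)" for k
    unfolding V_def by simp_all
  have V_stable: "V (k + i) t = V k t" if "t < S k" for k i t
  proof (induction i)
    case (Suc i)
    have "S k \<le> S (k + i)"
      using S_mono by (simp add: strict_mono_less_eq)
    then show ?case
      using Suc that by (simp add: V_Suc)
  qed simp
  define w where "w t = V (Suc t) t" for t
  have w_V: "w t = V k t" if "t < S k" for k t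
  proof (cases "Suc t \<le> k")
    case True
    have "t < S (Suc t)"
      using seq_suble[OF S_mono, of "Suc t"] by simp
    then show ?thesis
      using V_stable[of t "Suc t" "k - Suc t"] True by (simp add: w_def)
  next
    case False
    then show ?thesis
      using V_stable[OF that, of "Suc t - k"] by (simp add: w_def)
  qed
  have rest: "inf_set (V k) (S k) = [0]" and
    block: "inf_set (V (Suc k)) T = inf_set (W k) T" if "S k \<le> T" for k T
  proof -
    have glue: "inf_set (V (Suc k)) T = inf_set (W k) T" if "inf_set (V k) (S k) = [0]" "S k \<le> T" for k T
    proof (rule inf_set_glue[OF S(1)[of k] _ W(1)])
      show "inf_set (V (Suc k)) (S k) = [0]"
        using inf_set_cong[OF S(1)[of k], of "V (Suc k)" "V k"] that(1) by (simp add: V_Suc)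
    qed (use that in \<open>auto simp: V_Suc\<close>)
    show rest: "inf_set (V k) (S k) = [0]" for k
    proof (induction k)
      case 0
      show ?case
        by (simp add: V_0 w0)
    next
      case (Suc k)
      show ?case
        using glue[OF Suc, of "S (Suc k)"] S(2)[of k] W(2) by simp
    qed
    show "inf_set (V (Suc k)) T = inf_set (W k) T"
      by (rule glue[OF rest that])
  qed
  have energy_V: "energy (V k) (S k) \<le> energy w0 (S 0) + (\<Sum>j<k. (1/2)^j)" for k
  proof (induction k)
    case 0
    show ?case
      by (simp add: V_0)
  next
    case (Suc k)
    have "energy (V (Suc k)) (S (Suc k)) = energy (V (Suc k)) (S k) + (\<Sum>t\<in>{S k..<S (Suc k)}. (norm (V (Suc k) t))\<^sup>2)"
      using S(2)[of k] by (simp add: energy_def lessThan_atLeast0 sum.atLeastLessThan_concat)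
    also have "energy (V (Suc k)) (S k) = energy (V k) (S k)"
      by (rule energy_cong) (simp add: V_Suc)
    also have "(\<Sum>t\<in>{S k..<S (Suc k)}. (norm (V (Suc k) t))\<^sup>2) = (\<Sum>t\<in>{S k..<S (Suc k)}. (norm (W k t))\<^sup>2)"
      by (rule sum.cong) (auto simp: V_Suc)
    also have "\<dots> \<le> energy (W k) (S (Suc k))"
      unfolding energy_def by (rule sum_mono2) auto
    finally show ?case
      using Suc W(3)[of k] by simp
  qed
  have "w \<in> ell2"
    unfolding ell2_def
  proof (intro CollectI summableI_nonneg_bounded)
    fix n
    have "(\<Sum>t<n. (norm (w t))\<^sup>2) \<le> energy w (S n)"
      using energy_mono[OF seq_suble[OF S_mono], of w n] by (simp add: energy_def)
    also have "\<dots> = energy (V n) (S n)"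
      by (rule energy_cong) (rule w_V)
    also have "\<dots> \<le> energy w0 (S 0) + (\<Sum>j<n. (1/2)^j)"
      by (rule energy_V)
    also have "(\<Sum>j<n. (1/2::real)^j) \<le> 2"
      by (simp add: sum_gp_strict)
    finally show "(\<Sum>t<n. (norm (w t))\<^sup>2) \<le> energy w0 (S 0) + 2"
      by simp
  qed simp
  moreover have "w 0 \<noteq> 0"
    using w_V[of 0 0] S(1)[of 0] w0 by (simp add: V_0)
  moreover have "(\<Sum>j<k. j) \<le> card {t. t \<le> S k \<and> sends w t}" for k
  proof -
    have "(\<Sum>j<k. j) \<le> transmissions w 0 (S k)"
    proof (induction k)
      case (Suc k)
      have "transmissions w (S k) (S (Suc k)) = transmissions (V (Suc k)) (S k) (S (Suc k))"
        by (rule transmissions_cong) (rule w_V)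
      also have "\<dots> = transmissions (W k) (S k) (S (Suc k))"
        unfolding transmissions_def cl_sigma_def using block[of k]
        by (intro arg_cong[where f = card] Collect_cong) auto
      finally show ?case
        using Suc W(4)[of k] S(2)[of k] transmissions_add[of 0 "S k" "S (Suc k)" w] by simp
    qed simp
    also have "\<dots> \<le> card {t. t \<le> S k \<and> sends w t}"
      unfolding transmissions_def by (rule card_mono) auto
    finally show ?thesis .
  qed
  ultimately show thesis
    using that S_mono S(3) by blast
qed

end

section \<open>The transmission rate\<close>

text \<open>After \<open>k\<close> blocks there are at least \<open>k (k - 1) / 2\<close> transmissions in
  \<open>h k (k - 1) / 2 + O(k)\<close> steps.\<close>
lemma avg_rate_ge:
  assumes S: "strict_mono S" "\<And>k. S (Suc k) \<le> S k + k * h + N" and "1 \<le> h"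
    and card: "\<And>k. (\<Sum>j<k. j) \<le> card {t. t \<le> S k \<and> \<sigma> t}"
  shows "ereal (1 / real h) \<le> avg_rate \<sigma>"
proof -
  define X where "X s = ereal ((\<Sum>t<s. of_bool (\<sigma> t)) / real s)" for s
  define f where "f k = (real k * (real k - 1) / 2) / (real (S 0) + 1 + real k * (real k - 1) / 2 * real h + real k * real N)" for k :: nat
  have half: "real (\<Sum>j<k. j) = real k * (real k - 1) / 2" for k
    by (induction k) (auto simp: field_simps)
  have S_le: "real (S k) \<le> real (S 0) + real k * (real k - 1) / 2 * real h + real k * real N" for k
  proof (induction k)
    case (Suc k)
    have "real (S (Suc k)) \<le> real (S k) + real k * real h + real N"
      using S(2)[of k] by (metis of_nat_add of_nat_le_iff of_nat_mult)
    with Suc show ?case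
      by (simp add: algebra_simps add_divide_distrib diff_divide_distrib)
  qed simp
  have "ereal (f k) \<le> (X \<circ> (\<lambda>k. Suc (S k))) k" for k
  proof -
    have "real k * (real k - 1) / 2 \<le> real (card {t. t \<le> S k \<and> \<sigma> t})"
      using card[of k] half[of k] by (metis of_nat_le_iff)
    also have "{t. t \<le> S k \<and> \<sigma> t} = {..<Suc (S k)} \<inter> {t. \<sigma> t}"
      by auto
    also have "real (card \<dots>) = (\<Sum>t<Suc (S k). of_bool (\<sigma> t))"
      by (simp only: sum_of_bool_eq finite_lessThan)
    finally have "f k \<le> (\<Sum>t<Suc (S k). of_bool (\<sigma> t)) / real (Suc (S k))"
      unfolding f_def using S_le[of k] by (intro frac_le) (auto intro: sum_nonneg)
    then show ?thesis
      by (simp add: X_def)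
  qed
  moreover have "f \<longlonglongrightarrow> 1 / real h"
    unfolding f_def using assms(3) by real_asymp
  then have "(\<lambda>k. ereal (f k)) \<longlonglongrightarrow> ereal (1 / real h)"
    by simp
  then have "limsup (\<lambda>k. ereal (f k)) = ereal (1 / real h)"
    by (intro lim_imp_Limsup) auto
  ultimately have "ereal (1 / real h) \<le> limsup (X \<circ> (\<lambda>k. Suc (S k)))"
    by (metis (mono_tags, lifting) Limsup_mono always_eventually)
  also have "\<dots> \<le> limsup X"
    using S(1) by (intro limsup_subseq_mono) (simp add: strict_mono_def)
  finally show ?thesis
    unfolding avg_rate_def X_def .
qed

theorem theorem1:
  fixes A :: "real^'n^'n" and B :: "real^'m^'n"
    and C2 :: "real^'n^'p" and D21 :: "real^'m^'p"
    and \<mu>\<^sub>u :: "('n, 'm) controller" and \<mu>\<^sub>\<sigma> :: "'n scheduler"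
    and h hbar :: nat and \<gamma> :: real and v :: "real^'n"
  assumes "1 \<le> h"
    and "transpose C2 ** D21 = 0"
    and "controllable A B" and "observable A C2" and "pos_def (transpose D21 ** D21)"
    and "1 \<le> hbar"
    and "\<And>w s. w \<in> ell2 \<Longrightarrow> w 0 \<noteq> 0 \<Longrightarrow> 1 \<le> s \<Longrightarrow> cl_sigma A B \<mu>\<^sub>u \<mu>\<^sub>\<sigma> w s \<Longrightarrow>
           inter_time (cl_sigma A B \<mu>\<^sub>u \<mu>\<^sub>\<sigma> w) s \<le> enat hbar"
    and "gamma_periodic A B C2 D21 h < gamma_periodic A B C2 D21 (h + 1)"
    and "gamma_periodic A B C2 D21 h < ereal \<gamma>"
    and "ereal \<gamma> < gamma_periodic A B C2 D21 (h + 1)"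
    and "unit_min_eigenvector (mat (\<gamma>\<^sup>2) - M_seq A B C2 D21 \<gamma> (h + 1)) v"
    and "\<exists>\<epsilon>\<^sub>0>0. \<forall>\<xi>. \<forall>t\<ge>1.
           T_map A B C2 D21 \<mu>\<^sub>u \<mu>\<^sub>\<sigma> v \<xi> t 0 \<gamma> \<le> enat h \<or>
           (\<forall>\<epsilon>\<in>{-\<epsilon>\<^sub>0..\<epsilon>\<^sub>0}. T_map A B C2 D21 \<mu>\<^sub>u \<mu>\<^sub>\<sigma> v \<xi> t \<epsilon> \<gamma> > enat h)"
  shows "\<exists>w\<in>ell2. w 0 \<noteq> 0 \<and>
           ((sqnorm (cl_output A B C2 D21 \<mu>\<^sub>u \<mu>\<^sub>\<sigma> w) > ennreal (\<gamma>\<^sup>2) * sqnorm w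
               \<and> gamma_policy A B C2 D21 \<mu>\<^sub>u \<mu>\<^sub>\<sigma> \<ge> ereal \<gamma>
               \<and> ereal \<gamma> > gamma_periodic A B C2 D21 h)
            \<or> avg_rate (cl_sigma A B \<mu>\<^sub>u \<mu>\<^sub>\<sigma> w) \<ge> ereal (1 / real h))"
proof -
  let ?out = "cl_output A B C2 D21 \<mu>\<^sub>u \<mu>\<^sub>\<sigma>"
  have "0 \<le> gamma_periodic A B C2 D21 h"
    unfolding gamma_periodic_def by (rule Inf_greatest) auto
  then have "0 \<le> \<gamma>"
    using assms(9) by (metis ereal_less_eq(5) less_imp_le order_trans)
  obtain g where g: "\<gamma> < g" "ereal g < gamma_periodic A B C2 D21 (h + 1)"
    using ereal_dense2[OF assms(10)] by auto
  have b: "\<gamma>\<^sup>2 < g\<^sup>2"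
    using g(1) \<open>0 \<le> \<gamma>\<close> by (simp add: power_strict_mono)
  show ?thesis
  proof (cases "\<exists>w\<in>ell2. w 0 \<noteq> 0 \<and> sqnorm (?out w) > ennreal (\<gamma>\<^sup>2) * sqnorm w")
    case True
    then obtain w where w: "w \<in> ell2" "w 0 \<noteq> 0" "sqnorm (?out w) > ennreal (\<gamma>\<^sup>2) * sqnorm w"
      by blast
    have "ereal \<gamma> \<le> gamma_policy A B C2 D21 \<mu>\<^sub>u \<mu>\<^sub>\<sigma>"
      unfolding gamma_policy_def
    proof (rule Inf_greatest, clarify)
      fix \<gamma>'
      assume \<gamma>': "0 \<le> \<gamma>'" "\<forall>w\<in>ell2. sqnorm (?out w) \<le> ennreal (\<gamma>'\<^sup>2) * sqnorm w"
      have "\<not> \<gamma>' < \<gamma>"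
      proof
        assume "\<gamma>' < \<gamma>"
        then have "ennreal (\<gamma>'\<^sup>2) * sqnorm w \<le> ennreal (\<gamma>\<^sup>2) * sqnorm w"
          using \<gamma>'(1) by (intro mult_right_mono ennreal_leI power_mono) auto
        with w(1,3) \<gamma>'(2) show False
          by (meson le_less_trans not_le)
      qed
      then show "ereal \<gamma> \<le> ereal \<gamma>'"
        by simp
    qed
    with w assms(9) show ?thesis
      by blast
  next
    case False
    interpret attenuating_loop A B C2 D21 \<mu>\<^sub>u \<mu>\<^sub>\<sigma> \<gamma> "g\<^sup>2"
      using assms(2,5) b False by unfold_locales (auto simp: not_less)
    obtain P L K where PLK: "riccati_step A B C2 D21 (g\<^sup>2) P L K P" "selfadj P" "\<And>x. 0 \<le> qf P x"
      "\<And>x. qf P x \<le> \<gamma>\<^sup>2 * (norm x)\<^sup>2"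
      "\<And>w T. w 0 \<noteq> 0 \<Longrightarrow> 1 \<le> T \<Longrightarrow> sum (payoff w) {..<T} + qf P (state w T) \<le> 0"
      using riccati_solution by blast
    \<comment> \<open>Otherwise following the saddle trajectory would achieve \<open>g\<close> with period \<open>h + 1\<close>.\<close>
    have "\<exists>e. 0 < deviation_gain A B D21 (g\<^sup>2) P L K e (Suc h)"
    proof (rule ccontr)
      assume "\<not> ?thesis"
      then have "\<And>e. deviation_gain A B D21 (g\<^sup>2) P L K e (h + 1) \<le> 0"
        by (simp add: not_less)
      note periodic = periodic_controller[OF PLK(1-3) assms(2) _ _ this]
      have "gamma_periodic A B C2 D21 (h + 1) \<le> ereal g"
        unfolding gamma_periodic_def
        by (rule Inf_lower) (use periodic g(1) \<open>0 \<le> \<gamma>\<close> in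
          \<open>auto intro!: exI[of _ g] exI[of _ "\<lambda>k \<xi> r. K *v saddle_state A B L K \<xi> r"]\<close>)
      with g(2) show False
        by simp
    qed
    then obtain e where e: "0 < deviation_gain A B D21 (g\<^sup>2) P L K e (Suc h)"
      by blast
    interpret saddle_loop A B C2 D21 \<mu>\<^sub>u \<mu>\<^sub>\<sigma> \<gamma> "g\<^sup>2" P L K e h hbar
      using PLK e assms(7) by unfold_locales auto
    obtain w S where w: "w \<in> ell2" "w 0 \<noteq> 0" "strict_mono S"
      "\<And>k. S (Suc k) \<le> S k + k * h + hbar" "\<And>k. (\<Sum>j<k. j) \<le> card {t. t \<le> S k \<and> sends w t}"
      using frequent_transmissions by blast
    have "ereal (1 / real h) \<le> avg_rate (sends w)"
      by (rule avg_rate_ge[OF w(3,4) assms(1) w(5)])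
    with w(1,2) show ?thesis
      by blast
  qed
qed

end
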